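(* Let $p$ be a prime, $n\ge 1$ an integer, and let $F$ be a finite field of characteristic $p$ with $q=p^n$ elements. Let $U(F[C_4^2\times C_2])$ be the unit group of the group algebra $F[C_4^2\times C_2]$. (1) If $p=2$, then $$U(F[C_4^2\times C_2])\cong C_{4}^{3n}\times C_{2}^{25n}\times C_{2^n-1}.$$ (2) If $p\neq 2$, then $U(F[C_4^2\times C_2])$ is isomorphic to: - $C_{p^n-1}^{32}$, if $q\equiv 1\pmod 4$; - $C_{p^n-1}^{8}\times C_{p^{2n}-1}^{12}$, if $q\equiv -1\pmod 4$.
   Context: $C_m$ denotes the cyclic group of order $m$, and $C_m^k$ denotes the direct product of $k$ copies of $C_m$. For a group $G$ and a field $F$, $FG$ (also written $F[G]$) is the group algebra and $U(FG)$ is the multiplicative group of all its invertible elements. *)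

theory Defs
  imports "HOL-Algebra.Algebra" "HOL-Number_Theory.Cong"
begin

text \<open>
  \<open>group.ord\<close> is 0 for elements of infinite order, so characteristic 0 gets its usual value.
\<close>

definition characteristic :: "('a, 'b) ring_scheme \<Rightarrow> nat"
  where "characteristic R = group.ord (add_monoid R) \<one>\<^bsub>R\<^esub>"

text \<open>
  The element \<open>\<Sum> a\<^sub>g g\<close> of \<open>RG\<close> is the finitely supported coefficient function \<open>g \<mapsto> a\<^sub>g\<close>,
  set to \<open>undefined\<close> outside \<open>carrier G\<close>. In the convolution product the sum is
  taken over the support of the left factor: \<open>finsum\<close> over an infinite set is 0.
\<close>

definition group_algebra ::
    "('a, 'b) ring_scheme \<Rightarrow> ('g, 'c) monoid_scheme \<Rightarrow> ('a, 'g \<Rightarrow> 'a) module"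
  where "group_algebra R G =
    \<lparr>carrier = {f \<in> carrier G \<rightarrow>\<^sub>E carrier R. finite {x \<in> carrier G. f x \<noteq> \<zero>\<^bsub>R\<^esub>}},
     monoid.mult = (\<lambda>f h. \<lambda>g\<in>carrier G.
       \<Oplus>\<^bsub>R\<^esub>x\<in>{x \<in> carrier G. f x \<noteq> \<zero>\<^bsub>R\<^esub>}. f x \<otimes>\<^bsub>R\<^esub> h (inv\<^bsub>G\<^esub> x \<otimes>\<^bsub>G\<^esub> g)),
     one = (\<lambda>g\<in>carrier G. if g = \<one>\<^bsub>G\<^esub> then \<one>\<^bsub>R\<^esub> else \<zero>\<^bsub>R\<^esub>),
     ring.zero = (\<lambda>g\<in>carrier G. \<zero>\<^bsub>R\<^esub>),
     ring.add = (\<lambda>f h. \<lambda>g\<in>carrier G. f g \<oplus>\<^bsub>R\<^esub> h g),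
     smult = (\<lambda>a f. \<lambda>g\<in>carrier G. a \<otimes>\<^bsub>R\<^esub> f g)\<rparr>"

definition cyclic_power :: "nat \<Rightarrow> nat \<Rightarrow> (nat \<Rightarrow> int) monoid"
  where "cyclic_power m k = product_group {..<k} (\<lambda>_. integer_mod_group m)"

end

theory Submission
  imports Defs
begin

text \<open>In odd characteristic no inverse of the Fourier map is constructed. It is an injective
  homomorphism into a product of fields, and both sides have \<open>q^32\<close> elements, with 32 =
  8 + 2 * 12 in the second case. A \<open>product_group\<close> has all its factors in one type, so
  where \<open>F\<close> and \<open>F[i]\<close> occur together, \<open>F\<close> is represented by
  the pairs with imaginary part 0.

  For p = 2 this fails because the group order 32 vanishes in \<open>F\<close>, and \<open>V\<close>
  is identified by invariants instead: \<open>C_4^a \<times> C_2^b\<close> has order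
  \<open>2^(2a+b)\<close> and exactly \<open>2^a\<close> squares. Every element of \<open>F\<close>
  is a square, so the squares in \<open>V\<close> are all the elements of augmentation 1 supported
  on the 4 squares of \<open>G\<close>. One coefficient is fixed by the augmentation and 4 - 1 = 3
  are free. Hence a = 3n, and b = 31n - 2 * 3n = 25n.\<close>

text \<open>
  For \<open>p \<noteq> 2\<close>, let \<open>\<omega>\<close> be a primitive fourth root of unity in a field \<open>K \<supseteq> F\<close>. The
  nondegenerate bicharacter \<open>\<beta>(g, h) = \<omega>^(g\<^sub>1h\<^sub>1 + g\<^sub>2h\<^sub>2 + 2g\<^sub>3h\<^sub>3)\<close> identifies \<open>G\<close> with its dual, and
  Fourier inversion makes \<open>f \<mapsto> (\<Sum>g. f g \<beta>(g, h))\<close>, for \<open>h\<close> in \<open>G\<close>, jointly injective on \<open>FG\<close>.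
  If \<open>q \<equiv> 1 (mod 4)\<close> then \<open>K = F\<close>, and \<open>FG \<cong> F\<^sup>3\<^sup>2\<close> by counting. If \<open>q \<equiv> -1 (mod 4)\<close> then \<open>K = F[i]\<close>; the
  8 characters with \<open>h\<^sup>2 = 1\<close> have values in \<open>F\<close> and the other 24 form 12 conjugate pairs, so
  \<open>FG \<cong> F\<^sup>8 \<times> K\<^sup>1\<^sup>2\<close>, again by counting.

  For \<open>p = 2\<close>, \<open>(f\<^sup>2)(y)\<close> is the sum of \<open>f(x)\<^sup>2\<close> over \<open>x\<^sup>2 = y\<close>, because the other terms of the convolution
  cancel in pairs. Hence \<open>f\<^sup>4\<close> is the fourth power of the augmentation, the units are \<open>V \<times> F\<^sup>*\<close> with \<open>V\<close>
  the elements of augmentation 1, and \<open>V\<close> has exponent 4, with \<open>q\<^sup>3\<^sup>1\<close> elements and \<open>q\<^sup>3\<close> squares. These two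
  numbers determine \<open>V\<close>.
\<close>

section \<open>Products of groups\<close>

lemma product_group_reindex:
  assumes "bij_betw h I J"
  shows "product_group J G \<cong> product_group I (\<lambda>i. G (h i))"
proof (rule is_isoI, rule isoI)
  let ?f = "\<lambda>x. \<lambda>i\<in>I. x (h i)"
  have hI: "h i \<in> J" if "i \<in> I" for i
    using assms that by (auto simp: bij_betw_def)
  show "?f \<in> hom (product_group J G) (product_group I (\<lambda>i. G (h i)))"
    by (rule homI) (auto simp: hI PiE_iff fun_eq_iff)
  show "bij_betw ?f (carrier (product_group J G)) (carrier (product_group I (\<lambda>i. G (h i))))"
  proof (rule bij_betw_byWitness)
    let ?k = "inv_into I h"
    have k: "?k j \<in> I" "h (?k j) = j" if "j \<in> J" for j
      using assms that by (auto simp: bij_betw_def inv_into_into f_inv_into_f)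
    have kh: "?k (h i) = i" if "i \<in> I" for i
      using assms that by (auto simp: bij_betw_def)
    let ?g = "\<lambda>y. \<lambda>j\<in>J. y (?k j)"
    show "\<forall>x\<in>carrier (product_group J G). ?g (?f x) = x"
      by (auto simp: k fun_eq_iff PiE_iff extensional_def)
    show "\<forall>y\<in>carrier (product_group I (\<lambda>i. G (h i))). ?f (?g y) = y"
      by (auto simp: kh hI fun_eq_iff PiE_iff extensional_def)
    show "?f ` carrier (product_group J G) \<subseteq> carrier (product_group I (\<lambda>i. G (h i)))"
      by (auto simp: hI PiE_iff)
    show "?g ` carrier (product_group I (\<lambda>i. G (h i))) \<subseteq> carrier (product_group J G)"
    proof clarsimp
      fix y j assume "y \<in> (\<Pi>\<^sub>E i\<in>I. carrier (G (h i)))" "j \<in> J"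
      then have "y (?k j) \<in> carrier (G (h (?k j)))" using k(1) by (blast dest: PiE_mem)
      then show "y (?k j) \<in> carrier (G j)" using k \<open>j \<in> J\<close> by simp
    qed
  qed
qed

lemma product_group_Un_disjoint:
  assumes "I \<inter> J = {}"
  shows "product_group (I \<union> J) G \<cong> product_group I G \<times>\<times> product_group J G"
proof (rule is_isoI, rule isoI)
  let ?f = "\<lambda>x. (restrict x I, restrict x J)"
  show "?f \<in> hom (product_group (I \<union> J) G) (product_group I G \<times>\<times> product_group J G)"
    by (rule homI) (auto simp: PiE_iff fun_eq_iff)
  show "bij_betw ?f (carrier (product_group (I \<union> J) G))
     (carrier (product_group I G \<times>\<times> product_group J G))"
  proof (rule bij_betw_byWitness)
    let ?g = "\<lambda>(y, z). \<lambda>j\<in>I \<union> J. if j \<in> I then y j else z j"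
    show "\<forall>x\<in>carrier (product_group (I \<union> J) G). ?g (?f x) = x"
      by (auto simp: fun_eq_iff PiE_iff extensional_def)
    show "\<forall>y\<in>carrier (product_group I G \<times>\<times> product_group J G). ?f (?g y) = y"
      using assms by (auto simp: fun_eq_iff PiE_iff extensional_def)
  qed (use assms in \<open>auto simp: PiE_iff\<close>)
qed

lemma DirProd_cong:
  assumes "G \<cong> G'" "H \<cong> H'"
  shows "G \<times>\<times> H \<cong> G' \<times>\<times> H'"
proof -
  obtain f g where fg: "f \<in> iso G G'" "g \<in> iso H H'"
    using assms by (auto simp: is_iso_def)
  have "map_prod f g \<in> hom (G \<times>\<times> H) (G' \<times>\<times> H')"
    using fg by (intro homI) (auto simp: iso_def hom_def)
  moreover have "bij_betw (map_prod f g) (carrier (G \<times>\<times> H)) (carrier (G' \<times>\<times> H'))"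
    using fg unfolding iso_def by (auto intro: bij_betw_map_prod)
  ultimately show ?thesis by (blast intro: is_isoI isoI)
qed

lemma DirProd_assoc_iso: "(G \<times>\<times> H) \<times>\<times> I \<cong> G \<times>\<times> (H \<times>\<times> I)"
  by (rule is_isoI[of "\<lambda>((x, y), z). (x, y, z)"])
    (auto simp: iso_def hom_def inj_on_def bij_betw_def image_iff)

lemma product_group_iso_cyclic_power:
  assumes "finite J" "\<And>j. j \<in> J \<Longrightarrow> group (G j)" "\<And>j. j \<in> J \<Longrightarrow> G j \<cong> integer_mod_group m"
  shows "product_group J G \<cong> cyclic_power m (card J)"
proof -
  obtain h where h: "bij_betw h {..<card J} J"
    using ex_bij_betw_nat_finite[OF assms(1)] by (auto simp: atLeast0LessThan)
  have "product_group J G \<cong> product_group J (\<lambda>_. integer_mod_group m)"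
    by (rule iso_product_groupI) (auto simp: assms)
  also have "\<dots> \<cong> product_group {..<card J} (\<lambda>_. integer_mod_group m)"
    by (rule product_group_reindex[OF h])
  finally show ?thesis by (simp add: cyclic_power_def)
qed

section \<open>Powers with residue exponents, units of finite fields, split epimorphisms\<close>

text \<open>Elements of \<open>integer_mod_group m\<close> are integers, turned into exponents by
  \<open>nat\<close>. This is the law that makes such power maps homomorphisms, both for the cyclic
  unit group of a field and for the cyclic factors of orders 4 and 2 below.\<close>

lemma (in monoid) nat_pow_mod_add:
  assumes "a \<in> carrier G" "a [^] m = \<one>" "m > 0" "x \<ge> 0" "y \<ge> 0"
  shows "a [^] nat ((x + y) mod int m) = a [^] nat x \<otimes> a [^] nat y"
proof -
  have "a [^] (m * k + l) = a [^] l" for k l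
    using assms(1,2) by (simp add: nat_pow_mult[symmetric] nat_pow_pow[symmetric])
  from this[of "nat (x + y) div m" "nat (x + y) mod m"]
  have "a [^] (nat (x + y) mod m) = a [^] nat (x + y)" by simp
  then show ?thesis
    using assms nat_pow_mult[OF assms(1), of "nat x" "nat y"] by (simp add: nat_mod_distrib nat_add_distrib)
qed

lemma units_of_finite_field:
  assumes "field K" "finite (carrier K)"
  shows "units_of K \<cong> integer_mod_group (card (carrier K) - 1)"
proof -
  interpret field K by fact
  interpret M: group "units_of K" by (simp add: units_group)
  have U: "Multiplicative_Group.mult_of K = units_of K" by (rule mult_of_is_Units)
  let ?N = "card (carrier K) - 1"
  obtain a where a: "a \<in> carrier (units_of K)" "carrier (units_of K) = {a [^]\<^bsub>K\<^esub> i | i::nat. i \<in> UNIV}"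
    using finite_field_mult_group_has_gen[OF assms(2)] by (auto simp: U)
  have oN: "order (units_of K) = ?N"
    using assms(2) by (simp add: order_def units_of_carrier field_Units card_Diff_singleton)
  \<comment> \<open>Positivity matters because \<open>integer_mod_group 0\<close> is the infinite
    cyclic group.\<close>
  have N0: "?N > 0" using M.order_gt_0_iff_finite oN assms(2) by (metis Units_closed finite_subset subsetI units_of_carrier)
  have aN: "a [^]\<^bsub>units_of K\<^esub> ?N = \<one>\<^bsub>units_of K\<^esub>"
    using M.pow_order_eq_1[OF a(1)] oN by simp
  let ?f = "\<lambda>k::int. a [^]\<^bsub>units_of K\<^esub> nat k"
  have "?f \<in> hom (integer_mod_group ?N) (units_of K)"
  proof (rule homI)
    fix x y assume "x \<in> carrier (integer_mod_group ?N)" "y \<in> carrier (integer_mod_group ?N)"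
    then have "x \<ge> 0" "y \<ge> 0" using N0 by (auto simp: carrier_integer_mod_group)
    then show "?f (x \<otimes>\<^bsub>integer_mod_group ?N\<^esub> y) = ?f x \<otimes>\<^bsub>units_of K\<^esub> ?f y"
      unfolding mult_integer_mod_group by (rule M.nat_pow_mod_add[OF a(1) aN N0])
  qed (rule M.nat_pow_closed[OF a(1)])
  moreover have "bij_betw ?f (carrier (integer_mod_group ?N)) (carrier (units_of K))"
  proof -
    have "?f ` carrier (integer_mod_group ?N) = carrier (units_of K)"
    proof
      show "?f ` carrier (integer_mod_group ?N) \<subseteq> carrier (units_of K)"
        using M.nat_pow_closed[OF a(1)] by blast
      show "carrier (units_of K) \<subseteq> ?f ` carrier (integer_mod_group ?N)"
      proof
        fix x assume "x \<in> carrier (units_of K)"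
        then obtain i :: nat where i: "x = a [^]\<^bsub>units_of K\<^esub> i" using a(2)

          using units_of_pow a(1) by (auto simp: units_of_carrier)
        have "?f ((int i + 0) mod int ?N) = x"
          using M.nat_pow_mod_add[OF a(1) aN N0, of "int i" 0] i a(1) by simp
        moreover have "(int i + 0) mod int ?N \<in> carrier (integer_mod_group ?N)"
          using N0 by (simp add: carrier_integer_mod_group)
        ultimately show "x \<in> ?f ` carrier (integer_mod_group ?N)" by blast
      qed
    qed
    \<comment> \<open>Injectivity comes from counting: a surjection between finite sets of equal
      size.\<close>
    moreover have "card (carrier (integer_mod_group ?N)) = card (carrier (units_of K))"
      using N0 oN by (simp add: carrier_integer_mod_group order_def)
    ultimately show ?thesis
      using N0 by (metis bij_betw_def carrier_integer_mod_group eq_card_imp_inj_on finite_atLeastLessThan_int less_numeral_extra(3))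
  qed
  ultimately have "integer_mod_group ?N \<cong> units_of K" by (blast intro: is_isoI isoI)
  then show ?thesis
    by (simp add: group.iso_sym)
qed

text \<open>A homomorphic section \<open>s\<close> of \<open>f\<close> splits off \<open>H\<close>
  as a direct factor: \<open>x\<close> decomposes as \<open>x s(f x)^-1\<close> in the kernel times
  \<open>s(f x)\<close>. It will be applied to the augmentation, with the scalars as
  section.\<close>

lemma (in comm_group) split_epi_iso:
  assumes H: "group H" and f: "f \<in> hom G H" and s: "s \<in> hom H G"
    and fs: "\<And>y. y \<in> carrier H \<Longrightarrow> f (s y) = y"
  shows "G \<cong> G\<lparr>carrier := kernel G H f\<rparr> \<times>\<times> H"
proof -
  interpret H: group H by fact
  interpret f: group_hom G H f by unfold_locales (rule f)
  interpret s: group_hom H G s by unfold_locales (rule s)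
  let ?g = "\<lambda>(v, y). v \<otimes> s y"
  let ?K = "kernel G H f"
  have K: "v \<in> carrier G" "f v = \<one>\<^bsub>H\<^esub>" if "v \<in> ?K" for v
    using that by (auto simp: kernel_def)
  have "?g \<in> hom (G\<lparr>carrier := ?K\<rparr> \<times>\<times> H) G"
    by (rule homI) (auto simp: K m_ac)
  moreover have "bij_betw ?g (carrier (G\<lparr>carrier := ?K\<rparr> \<times>\<times> H)) (carrier G)"
  proof (rule bij_betw_byWitness)
    let ?h = "\<lambda>x. (x \<otimes> inv (s (f x)), f x)"
    show "\<forall>x\<in>carrier (G\<lparr>carrier := ?K\<rparr> \<times>\<times> H). ?h (?g x) = x"
      by (auto simp: K fs m_assoc)
    show "\<forall>x\<in>carrier G. ?g (?h x) = x" by (auto simp: m_assoc)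
    show "?g ` carrier (G\<lparr>carrier := ?K\<rparr> \<times>\<times> H) \<subseteq> carrier G" by (auto simp: K)
    show "?h ` carrier G \<subseteq> carrier (G\<lparr>carrier := ?K\<rparr> \<times>\<times> H)"
      by (auto simp: kernel_def fs)
  qed
  ultimately have "G\<lparr>carrier := ?K\<rparr> \<times>\<times> H \<cong> G" by (blast intro: is_isoI isoI)
  moreover have "group (G\<lparr>carrier := ?K\<rparr> \<times>\<times> H)"
    by (intro DirProd_group subgroup_imp_group f.subgroup_kernel H)
  ultimately show ?thesis by (simp add: group.iso_sym)
qed

section \<open>Finite abelian groups of exponent 4\<close>

context comm_group
begin

text \<open>For a finite set of involutions this is linear independence over the field with two
  elements: a subset \<open>S\<close> is the support of a 0/1 coefficient vector, and its product is
  the linear combination.\<close>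

definition independent2 :: "'a set \<Rightarrow> bool"
  where "independent2 B \<longleftrightarrow> B \<subseteq> carrier G \<and> (\<forall>S\<subseteq>B. finprod G (\<lambda>x. x) S = \<one> \<longrightarrow> S = {})"

lemma finprod_power2:
  assumes "A \<subseteq> carrier G" "finite A"
  shows "finprod G (\<lambda>x. x) A [^] (2::nat) = finprod G (\<lambda>x. x [^] (2::nat)) A"
  using assms(2,1) by (induction A rule: finite_induct) (auto simp: nat_pow_distrib Pi_iff subset_iff)

lemma finprod_involutions:
  assumes "finite A" "A \<subseteq> carrier G" "\<And>x. x \<in> A \<Longrightarrow> x [^] (2::nat) = \<one>"
  shows "finprod G (\<lambda>x. x) A [^] (2::nat) = \<one>"
  using assms by (simp add: finprod_power2 finprod_one_eqI)

text \<open>If \<open>S\<close> and \<open>T\<close> have equal products, cancelling the common part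
  shows that \<open>S - T\<close> and \<open>T - S\<close> have equal products too. The product over
  the symmetric difference is then a square of an involution or of the identity, so it is trivial
  and independence makes the symmetric difference empty.\<close>

lemma independent2_inj_on:
  assumes B: "independent2 B" "finite B" and sq: "\<And>x. x \<in> B \<Longrightarrow> x [^] (2::nat) = \<one>"
  shows "inj_on (finprod G (\<lambda>x. x)) (Pow B)"
proof (rule inj_onI)
  let ?P = "finprod G (\<lambda>x. x)"
  fix S T assume ST: "S \<in> Pow B" "T \<in> Pow B" "?P S = ?P T"
  have Bc: "B \<subseteq> carrier G" using B by (auto simp: independent2_def)
  have fin: "finite S" "finite T" using ST B finite_subset by auto
  have cl: "?P A \<in> carrier G" if "A \<subseteq> B" for A using that Bc by (intro finprod_closed) auto
  have split: "?P A = ?P (A - A') \<otimes> ?P (A \<inter> A')" if "A \<subseteq> B" for A A'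
  proof -
    have "finite A" using that B(2) finite_subset by auto
    then have "?P ((A - A') \<union> (A \<inter> A')) = ?P (A - A') \<otimes> ?P (A \<inter> A')"
      using that Bc by (intro finprod_Un_disjoint) auto
    then show ?thesis by (simp add: Un_Diff_Int)
  qed
  have TS: "T - S \<subseteq> B" using ST by auto
  have "?P (S - T) \<otimes> ?P (S \<inter> T) = ?P (T - S) \<otimes> ?P (S \<inter> T)"
    using split[of S T] split[of T S] ST by (simp add: Int_commute)
  then have eq: "?P (S - T) = ?P (T - S)"
    using right_cancel[OF cl cl cl, of "S \<inter> T" "S - T" "T - S"] ST by blast
  have "?P ((S - T) \<union> (T - S)) = ?P (S - T) \<otimes> ?P (T - S)"
    using ST Bc fin by (intro finprod_Un_disjoint) auto
  also have "\<dots> = ?P (T - S) [^] (2::nat)"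
    using eq cl[OF TS] by (simp add: numeral_2_eq_2)
  also have "\<dots> = \<one>" using ST Bc fin sq by (intro finprod_involutions) auto
  finally have "(S - T) \<union> (T - S) = {}"
    using B(1)[unfolded independent2_def, THEN conjunct2, rule_format, of "(S - T) \<union> (T - S)"] ST
    by blast
  then show "S = T" by blast
qed

text \<open>Extension to a basis. Take \<open>C\<close> maximal among the independent sets between
  \<open>B\<close> and \<open>E\<close>. If \<open>x\<close> is outside \<open>C\<close>, then
  \<open>insert x C\<close> carries a nontrivial relation, which must involve \<open>x\<close>;
  since the other factors have a product of order at most 2, the relation can be solved for
  \<open>x\<close>.\<close>

lemma independent2_extend:
  assumes E: "E \<subseteq> carrier G" "finite E" "\<And>x. x \<in> E \<Longrightarrow> x [^] (2::nat) = \<one>"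
    and B: "independent2 B" "B \<subseteq> E"
  obtains C where "B \<subseteq> C" "C \<subseteq> E" "independent2 C"
    "\<And>x. x \<in> E \<Longrightarrow> \<exists>T\<subseteq>C. finprod G (\<lambda>x. x) T = x"
proof -
  let ?P = "finprod G (\<lambda>x. x)"
  obtain C where C: "C \<subseteq> E" "independent2 C" "B \<subseteq> C"
    and max: "\<And>D. D \<subseteq> E \<Longrightarrow> independent2 D \<Longrightarrow> C \<subseteq> D \<Longrightarrow> C = D"
    using finite_has_maximal2[of "{C. C \<subseteq> E \<and> independent2 C}" B] E(2) B by auto
  have "\<exists>T\<subseteq>C. ?P T = x" if x: "x \<in> E" for x
  proof (cases "x \<in> C")
    case True
    then show ?thesis using x E by (intro exI[of _ "{x}"]) auto
  next
    case False
    then have "\<not> independent2 (insert x C)" using max[of "insert x C"] C x by auto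
    then obtain S where S: "S \<subseteq> insert x C" "?P S = \<one>" "S \<noteq> {}"
      using x E C by (auto simp: independent2_def)
    have xS: "x \<in> S"
    proof (rule ccontr)
      assume "x \<notin> S"
      then have "S \<subseteq> C" using S by auto
      then show False using S C by (auto simp: independent2_def)
    qed
    let ?T = "S - {x}"
    have T: "?T \<subseteq> C" using S by auto
    have fT: "finite ?T" using T C E finite_subset by metis
    have cl: "?P ?T \<in> carrier G" using T C E by (intro finprod_closed) auto
    have "?P (insert x ?T) = x \<otimes> ?P ?T"
      using fT T C E x by (intro finprod_insert) auto
    then have "x \<otimes> ?P ?T = \<one>" using S xS by (simp add: insert_absorb)
    moreover have "?P ?T [^] (2::nat) = \<one>" using T C E fT by (intro finprod_involutions) auto
    then have "?P ?T \<otimes> ?P ?T = \<one>" using cl by (simp add: numeral_2_eq_2)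
    ultimately have "?P ?T = x" using cl x E
      by (metis inv_equality subsetD)
    then show ?thesis using T by blast
  qed
  then show ?thesis using C that by blast
qed

text \<open>The squares \<open>?Q\<close> lie among the elements \<open>?E\<close> with trivial
  square. A basis \<open>B\<close> of \<open>?Q\<close> is extended to a basis \<open>C\<close> of
  \<open>?E\<close>, and each \<open>b\<close> in \<open>B\<close> gets a square root
  \<open>r b\<close>. The group is the direct product of the cyclic groups of order 4 generated by
  the \<open>r b\<close> and those of order 2 generated by \<open>C - B\<close>; the two given
  cardinalities fix the numbers of factors.\<close>

theorem exponent4_structure:
  assumes fin: "finite (carrier G)" and exp4: "\<And>x. x \<in> carrier G \<Longrightarrow> x [^] (4::nat) = \<one>"
    and N: "order G = 2 ^ N" and m: "card ((\<lambda>x. x [^] (2::nat)) ` carrier G) = 2 ^ m"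
  shows "G \<cong> cyclic_power 4 m \<times>\<times> cyclic_power 2 (N - 2 * m)"
proof -
  let ?P = "finprod G (\<lambda>x. x)"
  let ?Q = "(\<lambda>x. x [^] (2::nat)) ` carrier G"
  let ?E = "{x \<in> carrier G. x [^] (2::nat) = \<one>}"
  have QE: "?Q \<subseteq> ?E" using exp4 by (auto simp: nat_pow_pow)
  have "independent2 {}" by (auto simp: independent2_def)
  then obtain B where B: "B \<subseteq> ?Q" "independent2 B"
    and spanB: "\<And>x. x \<in> ?Q \<Longrightarrow> \<exists>T\<subseteq>B. ?P T = x"
    by (rule independent2_extend[of ?Q "{}", rotated 3]) (use QE fin in auto)
  obtain C where C: "B \<subseteq> C" "C \<subseteq> ?E" "independent2 C"
    and spanC: "\<And>x. x \<in> ?E \<Longrightarrow> \<exists>T\<subseteq>C. ?P T = x"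
    by (rule independent2_extend[of ?E B]) (use QE fin B in auto)
  have finC: "finite C" and finB: "finite B"
    using C fin finite_subset[of C "carrier G"] finite_subset[of B C] by auto
  have Cc: "C \<subseteq> carrier G" and Bc: "B \<subseteq> carrier G" using C by auto
  define r where "r b = (SOME a. a \<in> carrier G \<and> a [^] (2::nat) = b)" for b
  have r: "r b \<in> carrier G" "r b [^] (2::nat) = b" if "b \<in> B" for b
  proof -
    have "\<exists>a. a \<in> carrier G \<and> a [^] (2::nat) = b" using that B by auto
    from someI_ex[OF this] show "r b \<in> carrier G" "r b [^] (2::nat) = b" unfolding r_def by auto
  qed
  have r4: "r b [^] (4::nat) = \<one>" if "b \<in> B" for b using exp4 r that by auto
  have c2: "c [^] (2::nat) = \<one>" if "c \<in> C" for c using C that by auto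
  have indD: "S = {}" if "independent2 A" "S \<subseteq> A" "?P S = \<one>" for A S
    using that by (auto simp: independent2_def)
  let ?D = "C - B"
  let ?X = "product_group B (\<lambda>_. integer_mod_group 4)"
  let ?Y = "product_group ?D (\<lambda>_. integer_mod_group 2)"
  define \<Phi> where "\<Phi> = (\<lambda>(x, y). finprod G (\<lambda>b. r b [^] nat (x b)) B \<otimes> finprod G (\<lambda>c. c [^] nat (y c)) ?D)"
  have cl1: "finprod G (\<lambda>b. r b [^] (k b :: nat)) A \<in> carrier G" if "A \<subseteq> B" for A k
    using that r by (intro finprod_closed) auto
  have cl2: "finprod G (\<lambda>b. b [^] (k b :: nat)) A \<in> carrier G" if "A \<subseteq> C" for A k
    using that Cc by (intro finprod_closed) auto
  have X: "x b \<ge> 0" "x b < 4" if "x \<in> carrier ?X" "b \<in> B" for x b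
    using that by (auto simp: carrier_integer_mod_group PiE_iff)
  have Y: "y b \<ge> 0" "y b < 2" if "y \<in> carrier ?Y" "b \<in> ?D" for y b
    using that by (auto simp: carrier_integer_mod_group PiE_iff)
  interpret XY: group "?X \<times>\<times> ?Y" by (intro DirProd_group product_group) auto
  have hom: "\<Phi> \<in> hom (?X \<times>\<times> ?Y) G"
  proof (rule homI)
    fix u v assume uv: "u \<in> carrier (?X \<times>\<times> ?Y)" "v \<in> carrier (?X \<times>\<times> ?Y)"
    obtain x y x' y' where [simp]: "u = (x, y)" "v = (x', y')" by (cases u; cases v)
    have x: "x \<in> carrier ?X" "x' \<in> carrier ?X" and y: "y \<in> carrier ?Y" "y' \<in> carrier ?Y" using uv by auto
    have "finprod G (\<lambda>b. r b [^] nat ((x \<otimes>\<^bsub>?X\<^esub> x') b)) B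
       = finprod G (\<lambda>b. r b [^] nat (x b) \<otimes> r b [^] nat (x' b)) B"
      using X[OF x(1)] X[OF x(2)] r nat_pow_mod_add[OF r(1) r4]
      by (intro finprod_cong') auto
    also have "\<dots> = finprod G (\<lambda>b. r b [^] nat (x b)) B \<otimes> finprod G (\<lambda>b. r b [^] nat (x' b)) B"
      using r by (intro finprod_multf) auto
    finally have 1: "finprod G (\<lambda>b. r b [^] nat ((x \<otimes>\<^bsub>?X\<^esub> x') b)) B = \<dots>" .
    have "finprod G (\<lambda>c. c [^] nat ((y \<otimes>\<^bsub>?Y\<^esub> y') c)) ?D
       = finprod G (\<lambda>c. c [^] nat (y c) \<otimes> c [^] nat (y' c)) ?D"
      using Y[OF y(1)] Y[OF y(2)] Cc nat_pow_mod_add[OF _ c2]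
      by (intro finprod_cong') (auto simp: subset_iff)
    also have "\<dots> = finprod G (\<lambda>c. c [^] nat (y c)) ?D \<otimes> finprod G (\<lambda>c. c [^] nat (y' c)) ?D"
      using Cc by (intro finprod_multf) auto
    finally have 2: "finprod G (\<lambda>c. c [^] nat ((y \<otimes>\<^bsub>?Y\<^esub> y') c)) ?D = \<dots>" .
    show "\<Phi> (u \<otimes>\<^bsub>?X \<times>\<times> ?Y\<^esub> v) = \<Phi> u \<otimes> \<Phi> v"
      using 1 2 by (simp add: \<Phi>_def cl1 cl2 m_ac del: mult_product_group)
  qed (auto simp: \<Phi>_def cl1 cl2)
  interpret \<Phi>: group_hom "?X \<times>\<times> ?Y" G \<Phi> by unfold_locales (rule hom)
  have filt: "finprod G (\<lambda>b. if p b then b else \<one>) A = ?P {b \<in> A. p b}" if "A \<subseteq> C" for A p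
    using that finC Cc finite_subset[of A C]
    by (intro finprod_mono_neutral_cong_right) auto
  have inj: "inj_on \<Phi> (carrier (?X \<times>\<times> ?Y))"
  proof (subst \<Phi>.inj_on_one_iff, intro allI impI)
    fix u assume u: "u \<in> carrier (?X \<times>\<times> ?Y)" "\<Phi> u = \<one>"
    obtain x y where [simp]: "u = (x, y)" by (cases u)
    have x: "x \<in> carrier ?X" and y: "y \<in> carrier ?Y" using u by auto
    have pow2: "c [^] n = (if odd n then c else \<one>)" if "c \<in> C" for c and n :: nat
    proof (cases "even n")
      case True
      then obtain k where "n = 2 * k" by blast
      then show ?thesis using that c2 Cc by (auto simp flip: nat_pow_pow)
    next
      case False
      then obtain k where "n = 2 * k + 1" using oddE by blast
      then show ?thesis using that c2 Cc by (auto simp flip: nat_pow_pow)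
    qed
    have psq: "finprod G f A [^] (2::nat) = finprod G (\<lambda>b. f b [^] (2::nat)) A"
      if "finite A" "f \<in> A \<rightarrow> carrier G" for f :: "'a \<Rightarrow> 'a" and A
      using that by (induction A rule: finite_induct) (auto simp: nat_pow_distrib Pi_iff)
    \<comment> \<open>Squaring kills the factors from \<open>?D\<close> and leaves the product of
      those \<open>b\<close> whose exponent is odd. Independence of \<open>B\<close> then makes
      every exponent \<open>x b\<close> even.\<close>
    have "\<one> = \<Phi> u [^] (2::nat)" using u by simp
    also have "\<dots> = finprod G (\<lambda>b. (r b [^] nat (x b)) [^] (2::nat)) B \<otimes>
        finprod G (\<lambda>c. (c [^] nat (y c)) [^] (2::nat)) ?D"
      using r Cc finB finC by (subst (1 2) psq[symmetric]) (auto simp: \<Phi>_def nat_pow_distrib cl1 cl2)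
    also have "finprod G (\<lambda>c. (c [^] nat (y c)) [^] (2::nat)) ?D = \<one>"
      using Cc c2 by (intro finprod_one_eqI) (metis DiffD1 nat_pow_one nat_pow_pow mult.commute subsetD)
    also have "finprod G (\<lambda>b. (r b [^] nat (x b)) [^] (2::nat)) B
        = finprod G (\<lambda>b. if odd (nat (x b)) then b else \<one>) B"
    proof (rule finprod_cong')
      fix b assume b: "b \<in> B"
      have "(r b [^] nat (x b)) [^] (2::nat) = (r b [^] (2::nat)) [^] nat (x b)"
        by (simp only: nat_pow_pow[OF r(1)[OF b]] mult.commute)
      then show "(r b [^] nat (x b)) [^] (2::nat) = (if odd (nat (x b)) then b else \<one>)"
        using pow2 r b C by auto
    qed (use Bc in auto)
    also have "\<dots> = ?P {b \<in> B. odd (nat (x b))}" using filt C by auto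
    finally have "?P {b \<in> B. odd (nat (x b))} = \<one>" using Bc by (simp add: finprod_closed Pi_iff subset_iff)
    then have "{b \<in> B. odd (nat (x b))} = {}" by (intro indD[OF B(2)]) auto
    then have ev: "even (nat (x b))" if "b \<in> B" for b using that by auto
    \<comment> \<open>With exponents 0 or 2 and \<open>(r b)^2 = b\<close>, the element
      \<open>\<Phi> u\<close> itself is a subset product of \<open>C\<close>, so independence of
      \<open>C\<close> finishes the argument.\<close>
    have x02: "x b = 0 \<or> x b = 2" if "b \<in> B" for b
      using X[OF x that] ev[OF that] by (cases "x b = 1"; cases "x b = 3"; force)
    have y01: "y c = 0 \<or> y c = 1" if "c \<in> ?D" for c using Y[OF y that] by auto
    have "finprod G (\<lambda>b. r b [^] nat (x b)) B = finprod G (\<lambda>b. if x b = 2 then b else \<one>) B"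
    proof (rule finprod_cong')
      fix b assume b: "b \<in> B"
      show "r b [^] nat (x b) = (if x b = 2 then b else \<one>)"
        using x02[OF b] r[OF b] by auto
    qed (use Bc in auto)
    also have "\<dots> = ?P {b \<in> B. x b = 2}" using filt C by auto
    finally have 1: "finprod G (\<lambda>b. r b [^] nat (x b)) B = \<dots>" .
    have "finprod G (\<lambda>c. c [^] nat (y c)) ?D = finprod G (\<lambda>c. if y c = 1 then c else \<one>) ?D"
    proof (rule finprod_cong')
      fix c assume c: "c \<in> ?D"
      show "c [^] nat (y c) = (if y c = 1 then c else \<one>)"
        using y01[OF c] c Cc by auto
    qed (use Cc in auto)
    also have "\<dots> = ?P {c \<in> ?D. y c = 1}" using filt C by auto
    finally have 2: "finprod G (\<lambda>c. c [^] nat (y c)) ?D = \<dots>" .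
    have "?P ({b \<in> B. x b = 2} \<union> {c \<in> ?D. y c = 1}) = ?P {b \<in> B. x b = 2} \<otimes> ?P {c \<in> ?D. y c = 1}"
      using finB finC Bc Cc by (intro finprod_Un_disjoint) auto
    also have "\<dots> = \<one>" using u 1 2 by (simp add: \<Phi>_def)
    finally have *: "{b \<in> B. x b = 2} \<union> {c \<in> ?D. y c = 1} = {}"
      by (intro indD[OF C(3)]) (use C in auto)
    then have "x b = 0" if "b \<in> B" for b using x02[OF that] that by auto
    moreover have "y c = 0" if "c \<in> ?D" for c using * y01[OF that] that by auto
    ultimately have "x = (\<lambda>i\<in>B. 0)" "y = (\<lambda>i\<in>?D. 0)"
      using x y by (auto simp: PiE_iff extensional_def fun_eq_iff)
    then show "u = \<one>\<^bsub>?X \<times>\<times> ?Y\<^esub>" by (simp add: DirProd_def)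
  qed
  have surj: "\<Phi> ` carrier (?X \<times>\<times> ?Y) = carrier G"
  proof
    show "\<Phi> ` carrier (?X \<times>\<times> ?Y) \<subseteq> carrier G" using \<Phi>.hom_closed by blast
    show "carrier G \<subseteq> \<Phi> ` carrier (?X \<times>\<times> ?Y)"
    proof
      fix v assume v: "v \<in> carrier G"
      then obtain S where S: "S \<subseteq> B" "?P S = v [^] (2::nat)" using spanB[of "v [^] (2::nat)"] by auto
      have finS: "finite S" using S finB finite_subset by auto
      \<comment> \<open>\<open>?R\<close> has the same square as \<open>v\<close>, so they differ by
        an element of \<open>?E\<close>, which is a subset product of \<open>C\<close>.\<close>
      let ?R = "finprod G r S"
      have R: "?R \<in> carrier G" using r S by (intro finprod_closed) auto
      have "?R [^] (2::nat) = ?P S"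
        using finS S(1) r by (induction S rule: finite_induct) (auto simp: nat_pow_distrib Pi_iff subset_iff Bc[THEN subsetD])
      then have R2: "?R [^] (2::nat) = v [^] (2::nat)" using S by simp
      have "(inv ?R \<otimes> v) [^] (2::nat) = \<one>"
        using R2 R v by (simp add: nat_pow_distrib nat_pow_inv)
      then obtain T where T: "T \<subseteq> C" "?P T = inv ?R \<otimes> v"
        using spanC[of "inv ?R \<otimes> v"] R v by auto
      \<comment> \<open>A basis element \<open>b\<close> in \<open>T\<close> contributes 2 because
        \<open>b = (r b)^2\<close>, and membership in \<open>S\<close> contributes 1 from
        \<open>?R\<close>. The sum is at most 3, so no reduction modulo 4 is needed.\<close>
      define x where "x = (\<lambda>b\<in>B. (if b \<in> S then 1 else 0) + (if b \<in> T then 2 else 0) :: int)"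
      define y where "y = (\<lambda>c\<in>?D. (if c \<in> T then 1 else 0) :: int)"
      have xy: "(x, y) \<in> carrier (?X \<times>\<times> ?Y)"
        by (auto simp: x_def y_def carrier_integer_mod_group)
      have "finprod G (\<lambda>b. r b [^] nat (x b)) B
        = finprod G (\<lambda>b. (if b \<in> S then r b else \<one>) \<otimes> (if b \<in> T then b else \<one>)) B"
      proof (rule finprod_cong')
        fix b assume b: "b \<in> B"
        have bc: "b \<in> carrier G" using b Bc by blast
        have xb: "nat (x b) = (if b \<in> S then 1 else 0) + (if b \<in> T then 2 else 0)"
          using b by (simp add: x_def)
        have "r b \<otimes> r b = b"
          using r[OF b] by (simp add: numeral_2_eq_2)
        then show "r b [^] nat (x b) = (if b \<in> S then r b else \<one>) \<otimes> (if b \<in> T then b else \<one>)"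
          using r[OF b] b bc by (cases "b \<in> S"; cases "b \<in> T") (simp_all add: xb m_comm)
      qed (use r Bc in auto)
      also have "\<dots> = finprod G (\<lambda>b. if b \<in> S then r b else \<one>) B \<otimes> finprod G (\<lambda>b. if b \<in> T then b else \<one>) B"
        using r Bc by (intro finprod_multf) auto
      also have "finprod G (\<lambda>b. if b \<in> S then r b else \<one>) B = ?R"
        using S finB r by (intro finprod_mono_neutral_cong_right) auto
      also have "finprod G (\<lambda>b. if b \<in> T then b else \<one>) B = ?P {b \<in> B. b \<in> T}" using filt C by auto
      finally have 1: "finprod G (\<lambda>b. r b [^] nat (x b)) B = ?R \<otimes> ?P {b \<in> B. b \<in> T}" .
      have "finprod G (\<lambda>c. c [^] nat (y c)) ?D = finprod G (\<lambda>c. if c \<in> T then c else \<one>) ?D"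
        using Cc by (intro finprod_cong') (auto simp: y_def)
      also have "\<dots> = ?P {c \<in> ?D. c \<in> T}" using filt C by auto
      finally have 2: "finprod G (\<lambda>c. c [^] nat (y c)) ?D = \<dots>" .
      have "?P ({b \<in> B. b \<in> T} \<union> {c \<in> ?D. c \<in> T}) = ?P {b \<in> B. b \<in> T} \<otimes> ?P {c \<in> ?D. c \<in> T}"
        using finB finC Bc Cc by (intro finprod_Un_disjoint) auto
      moreover have "{b \<in> B. b \<in> T} \<union> {c \<in> ?D. c \<in> T} = T" using T C by auto
      ultimately have "\<Phi> (x, y) = ?R \<otimes> ?P T"
        using R Bc Cc by (simp add: \<Phi>_def 1 2 m_assoc Pi_iff subset_iff)
      also have "\<dots> = v" using T R v by (simp flip: m_assoc)
      finally show "v \<in> \<Phi> ` carrier (?X \<times>\<times> ?Y)" using xy by blast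
    qed
  qed
  have iso: "?X \<times>\<times> ?Y \<cong> G" using hom inj surj by (auto intro!: is_isoI isoI simp: bij_betw_def)
  \<comment> \<open>The squares are exactly the subset products of \<open>B\<close>. By independence
    there are \<open>2 ^ card B\<close> of them, hence \<open>card B = m\<close>.\<close>
  have "?P ` Pow B = ?Q"
  proof
    show "?P ` Pow B \<subseteq> ?Q"
    proof clarify
      fix S assume S: "S \<subseteq> B"
      have finS: "finite S" using S finB finite_subset by auto
      have "finprod G r S [^] (2::nat) = ?P S"
        using finS S r by (induction S rule: finite_induct) (auto simp: nat_pow_distrib Pi_iff subset_iff Bc[THEN subsetD])
      moreover have "finprod G r S \<in> carrier G" using r S by (intro finprod_closed) auto
      ultimately show "?P S \<in> ?Q" by (metis imageI)
    qed
    show "?Q \<subseteq> ?P ` Pow B"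
    proof
      fix x assume "x \<in> ?Q"
      then obtain T where "T \<subseteq> B" "?P T = x" using spanB by auto
      then show "x \<in> ?P ` Pow B" by auto
    qed
  qed
  moreover have "inj_on ?P (Pow B)"
    using C c2 by (intro independent2_inj_on[OF B(2) finB]) auto
  ultimately have "2 ^ m = card (Pow B)"
    using m card_image by fastforce
  then have mB: "card B = m" using finB by (simp add: card_Pow)
  have "2 ^ N = card (carrier (?X \<times>\<times> ?Y))"
    using N surj inj by (metis card_image order_def)
  also have "\<dots> = 4 ^ m * 2 ^ card ?D"
    using finB finC mB by (simp add: card_cartesian_product card_PiE carrier_integer_mod_group)
  also have "\<dots> = 2 ^ (2 * m + card ?D)" by (simp add: power_add power_mult)
  finally have D: "card ?D = N - 2 * m" by simp
  have "G \<cong> ?X \<times>\<times> ?Y" using iso XY.iso_sym by blast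
  also have "\<dots> \<cong> cyclic_power 4 m \<times>\<times> cyclic_power 2 (N - 2 * m)"
    using product_group_iso_cyclic_power[of B "\<lambda>_. integer_mod_group 4" 4]
      product_group_iso_cyclic_power[of ?D "\<lambda>_. integer_mod_group 2" 2]
      finB finC mB D by (intro DirProd_cong) auto
  finally show ?thesis .
qed

end

section \<open>Group algebras of finite abelian groups\<close>

text \<open>Stated for products in a commutative monoid; its use is in additive monoids of rings,
  where it interchanges the double sums of convolutions and Fourier transforms.\<close>

lemma (in comm_monoid) finprod_swap:
  assumes "finite A" "finite B" "\<And>a b. a \<in> A \<Longrightarrow> b \<in> B \<Longrightarrow> f a b \<in> carrier G"
  shows "finprod G (\<lambda>a. finprod G (\<lambda>b. f a b) B) A = finprod G (\<lambda>b. finprod G (\<lambda>a. f a b) A) B"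
  using assms(1,3)
proof (induction A rule: finite_induct)
  case (insert a A)
  have "finprod G (\<lambda>b. finprod G (\<lambda>a. f a b) (insert a A)) B
      = finprod G (\<lambda>b. f a b \<otimes> finprod G (\<lambda>a. f a b) A) B"
    using insert by (intro finprod_cong') (auto intro!: m_closed finprod_closed)
  also have "\<dots> = finprod G (f a) B \<otimes> finprod G (\<lambda>b. finprod G (\<lambda>a. f a b) A) B"
    using insert by (intro finprod_multf) (auto intro!: finprod_closed)
  also have "finprod G (\<lambda>b. finprod G (\<lambda>a. f a b) A) B = finprod G (\<lambda>a. finprod G (\<lambda>b. f a b) B) A"
    using insert by auto
  finally show ?case
    using insert by (simp add: finprod_closed Pi_iff)
qed simp

text \<open>With \<open>G\<close> finite, the support condition is automatic and convolutions may be
  summed over all of \<open>G\<close>. Allowing any commutative ring of coefficients lets the same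
  locale be interpreted for an extension of \<open>R\<close>, which supplies translation of sums
  with values there.\<close>

locale finite_group_ring = R?: cring R + G: comm_group G for R (structure) and G (structure) +
  assumes finite_G: "finite (carrier G)"
begin

abbreviation A where "A \<equiv> group_algebra R G"

lemma carrier_A: "carrier A = carrier G \<rightarrow>\<^sub>E carrier R"
  using finite_G by (auto simp: group_algebra_def)

lemma closed_A [simp]: "f \<in> carrier A \<Longrightarrow> x \<in> carrier G \<Longrightarrow> f x \<in> carrier R"
  by (auto simp: carrier_A PiE_iff)

lemma ext_A:
  assumes "f \<in> carrier A" "h \<in> carrier A" "\<And>x. x \<in> carrier G \<Longrightarrow> f x = h x"
  shows "f = h"
  using assms by (auto simp: carrier_A intro: PiE_ext)

lemma mult_A:
  assumes "f \<in> carrier A" "h \<in> carrier A" "g \<in> carrier G"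
  shows "(f \<otimes>\<^bsub>A\<^esub> h) g = (\<Oplus>x\<in>carrier G. f x \<otimes> h (inv\<^bsub>G\<^esub> x \<otimes>\<^bsub>G\<^esub> g))"
proof -
  have "(f \<otimes>\<^bsub>A\<^esub> h) g = (\<Oplus>x\<in>{x \<in> carrier G. f x \<noteq> \<zero>}. f x \<otimes> h (inv\<^bsub>G\<^esub> x \<otimes>\<^bsub>G\<^esub> g))"
    using assms by (simp add: group_algebra_def)
  also have "\<dots> = (\<Oplus>x\<in>carrier G. f x \<otimes> h (inv\<^bsub>G\<^esub> x \<otimes>\<^bsub>G\<^esub> g))"
    using assms finite_G by (intro add.finprod_mono_neutral_cong_left) auto
  finally show ?thesis .
qed

lemma mult_A_closed:
  assumes "f \<in> carrier A" "h \<in> carrier A"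
  shows "f \<otimes>\<^bsub>A\<^esub> h \<in> carrier A"
  unfolding carrier_A
proof (rule PiE_I)
  show "(f \<otimes>\<^bsub>A\<^esub> h) g \<in> carrier R" if "g \<in> carrier G" for g
    using assms that by (auto simp: mult_A intro!: finsum_closed)
qed (simp add: group_algebra_def)

lemma inv_mult_cancel:
  "x \<in> carrier G \<Longrightarrow> y \<in> carrier G \<Longrightarrow> inv\<^bsub>G\<^esub> x \<otimes>\<^bsub>G\<^esub> (x \<otimes>\<^bsub>G\<^esub> y) = y"
  by (simp flip: G.m_assoc)

lemma finsum_translate:
  assumes "a \<in> carrier G" "t \<in> carrier G \<rightarrow> carrier R"
  shows "(\<Oplus>x\<in>carrier G. t (a \<otimes>\<^bsub>G\<^esub> x)) = (\<Oplus>x\<in>carrier G. t x)"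
  using add.finprod_reindex[of t "\<lambda>x. a \<otimes>\<^bsub>G\<^esub> x" "carrier G"] assms
  by (simp add: G.surj_const_mult G.inj_on_cmult)

lemma finsum_inverse:
  assumes "t \<in> carrier G \<rightarrow> carrier R"
  shows "(\<Oplus>x\<in>carrier G. t (inv\<^bsub>G\<^esub> x)) = (\<Oplus>x\<in>carrier G. t x)"
proof -
  have "m_inv G ` carrier G = carrier G"
    by (auto simp: image_iff) (metis G.inv_closed G.inv_inv)
  moreover have "inj_on (m_inv G) (carrier G)" by (metis G.inv_inv inj_onI)
  ultimately show ?thesis
    using add.finprod_reindex[of t "m_inv G" "carrier G"] assms by simp
qed

text \<open>Replacing \<open>x\<close> by \<open>g x\<close> and then \<open>x\<close> by its
  inverse amounts to the substitution of \<open>g x^-1\<close> for \<open>x\<close>, which exchanges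
  the two arguments of the convolution.\<close>

lemma mult_A_comm:
  assumes f: "f \<in> carrier A" and h: "h \<in> carrier A"
  shows "f \<otimes>\<^bsub>A\<^esub> h = h \<otimes>\<^bsub>A\<^esub> f"
proof (rule ext_A)
  fix g assume g: "g \<in> carrier G"
  have "(h \<otimes>\<^bsub>A\<^esub> f) g = (\<Oplus>x\<in>carrier G. h x \<otimes> f (inv\<^bsub>G\<^esub> x \<otimes>\<^bsub>G\<^esub> g))"
    using assms g by (simp add: mult_A)
  also have "\<dots> = (\<Oplus>x\<in>carrier G. h (g \<otimes>\<^bsub>G\<^esub> x) \<otimes> f (inv\<^bsub>G\<^esub> (g \<otimes>\<^bsub>G\<^esub> x) \<otimes>\<^bsub>G\<^esub> g))"
    using assms g by (subst finsum_translate[OF g]) auto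
  also have "\<dots> = (\<Oplus>x\<in>carrier G. h (g \<otimes>\<^bsub>G\<^esub> inv\<^bsub>G\<^esub> x) \<otimes> f (inv\<^bsub>G\<^esub> (g \<otimes>\<^bsub>G\<^esub> inv\<^bsub>G\<^esub> x) \<otimes>\<^bsub>G\<^esub> g))"
    using assms g by (subst finsum_inverse[symmetric]) auto
  also have "\<dots> = (\<Oplus>x\<in>carrier G. f x \<otimes> h (inv\<^bsub>G\<^esub> x \<otimes>\<^bsub>G\<^esub> g))"
  proof (rule finsum_cong')
    fix x assume x: "x \<in> carrier G"
    have "inv\<^bsub>G\<^esub> (g \<otimes>\<^bsub>G\<^esub> inv\<^bsub>G\<^esub> x) \<otimes>\<^bsub>G\<^esub> g = x" "g \<otimes>\<^bsub>G\<^esub> inv\<^bsub>G\<^esub> x = inv\<^bsub>G\<^esub> x \<otimes>\<^bsub>G\<^esub> g"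
      using x g by (simp_all add: G.inv_mult_group G.m_assoc) (simp add: G.m_comm)
    then show "h (g \<otimes>\<^bsub>G\<^esub> inv\<^bsub>G\<^esub> x) \<otimes> f (inv\<^bsub>G\<^esub> (g \<otimes>\<^bsub>G\<^esub> inv\<^bsub>G\<^esub> x) \<otimes>\<^bsub>G\<^esub> g) = f x \<otimes> h (inv\<^bsub>G\<^esub> x \<otimes>\<^bsub>G\<^esub> g)"
      using x g f h by (simp add: R.m_comm)
  qed (use f h g in auto)
  finally show "(f \<otimes>\<^bsub>A\<^esub> h) g = (h \<otimes>\<^bsub>A\<^esub> f) g"
    using assms g by (simp add: mult_A)
qed (use assms in \<open>auto intro: mult_A_closed\<close>)

text \<open>After interchanging the two sums, the substitution \<open>y = x z\<close> in the inner
  one turns it into the convolution of \<open>h\<close> and \<open>k\<close>.\<close>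

lemma mult_A_assoc:
  assumes f: "f \<in> carrier A" and h: "h \<in> carrier A" and k: "k \<in> carrier A"
  shows "f \<otimes>\<^bsub>A\<^esub> h \<otimes>\<^bsub>A\<^esub> k = f \<otimes>\<^bsub>A\<^esub> (h \<otimes>\<^bsub>A\<^esub> k)"
proof (rule ext_A)
  fix g assume g: "g \<in> carrier G"
  note [simp] = f h k g mult_A mult_A_closed finite_G
  have "(f \<otimes>\<^bsub>A\<^esub> h \<otimes>\<^bsub>A\<^esub> k) g
    = (\<Oplus>y\<in>carrier G. (\<Oplus>x\<in>carrier G. f x \<otimes> h (inv\<^bsub>G\<^esub> x \<otimes>\<^bsub>G\<^esub> y)) \<otimes> k (inv\<^bsub>G\<^esub> y \<otimes>\<^bsub>G\<^esub> g))"
    by (simp cong: finsum_cong)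
  also have "\<dots> = (\<Oplus>y\<in>carrier G. \<Oplus>x\<in>carrier G. f x \<otimes> h (inv\<^bsub>G\<^esub> x \<otimes>\<^bsub>G\<^esub> y) \<otimes> k (inv\<^bsub>G\<^esub> y \<otimes>\<^bsub>G\<^esub> g))"
    by (intro finsum_cong' finsum_ldistr) (auto intro!: finsum_closed)
  also have "\<dots> = (\<Oplus>x\<in>carrier G. \<Oplus>y\<in>carrier G. f x \<otimes> h (inv\<^bsub>G\<^esub> x \<otimes>\<^bsub>G\<^esub> y) \<otimes> k (inv\<^bsub>G\<^esub> y \<otimes>\<^bsub>G\<^esub> g))"
    by (intro add.finprod_swap) auto
  also have "\<dots> = (\<Oplus>x\<in>carrier G. f x \<otimes> (h \<otimes>\<^bsub>A\<^esub> k) (inv\<^bsub>G\<^esub> x \<otimes>\<^bsub>G\<^esub> g))"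
  proof (rule finsum_cong')
    fix x assume x: "x \<in> carrier G"
    have "(\<Oplus>y\<in>carrier G. f x \<otimes> h (inv\<^bsub>G\<^esub> x \<otimes>\<^bsub>G\<^esub> y) \<otimes> k (inv\<^bsub>G\<^esub> y \<otimes>\<^bsub>G\<^esub> g))
        = (\<Oplus>z\<in>carrier G. f x \<otimes> h (inv\<^bsub>G\<^esub> x \<otimes>\<^bsub>G\<^esub> (x \<otimes>\<^bsub>G\<^esub> z)) \<otimes> k (inv\<^bsub>G\<^esub> (x \<otimes>\<^bsub>G\<^esub> z) \<otimes>\<^bsub>G\<^esub> g))"
      using x by (subst finsum_translate[OF x]) auto
    also have "\<dots> = (\<Oplus>z\<in>carrier G. f x \<otimes> (h z \<otimes> k (inv\<^bsub>G\<^esub> z \<otimes>\<^bsub>G\<^esub> (inv\<^bsub>G\<^esub> x \<otimes>\<^bsub>G\<^esub> g))))"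
      using x by (intro finsum_cong') (auto simp: R.m_assoc inv_mult_cancel G.m_assoc G.inv_mult_group)
    also have "\<dots> = f x \<otimes> (h \<otimes>\<^bsub>A\<^esub> k) (inv\<^bsub>G\<^esub> x \<otimes>\<^bsub>G\<^esub> g)"
      using x by (simp add: finsum_rdistr Pi_iff)
    finally show "(\<Oplus>y\<in>carrier G. f x \<otimes> h (inv\<^bsub>G\<^esub> x \<otimes>\<^bsub>G\<^esub> y) \<otimes> k (inv\<^bsub>G\<^esub> y \<otimes>\<^bsub>G\<^esub> g)) = \<dots>" .
  qed (auto intro!: finsum_closed)
  finally show "(f \<otimes>\<^bsub>A\<^esub> h \<otimes>\<^bsub>A\<^esub> k) g = (f \<otimes>\<^bsub>A\<^esub> (h \<otimes>\<^bsub>A\<^esub> k)) g"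
    by simp
qed (use assms in \<open>auto intro: mult_A_closed\<close>)

text \<open>This is the element \<open>a g\<close> of the group algebra; for \<open>g\<close> the
  identity it is the scalar \<open>a\<close>.\<close>

definition single :: "'c \<Rightarrow> 'a \<Rightarrow> ('c \<Rightarrow> 'a)"
  where "single g a = (\<lambda>x\<in>carrier G. if x = g then a else \<zero>)"

lemma single_closed [simp]: "a \<in> carrier R \<Longrightarrow> single g a \<in> carrier A"
  by (auto simp: single_def carrier_A)

lemma one_A: "\<one>\<^bsub>A\<^esub> = single \<one>\<^bsub>G\<^esub> \<one>"
  by (simp add: group_algebra_def single_def)

lemma single_mult:
  assumes "a \<in> carrier R" "f \<in> carrier A" "g \<in> carrier G"
  shows "(single \<one>\<^bsub>G\<^esub> a \<otimes>\<^bsub>A\<^esub> f) g = a \<otimes> f g"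
proof -
  have "(single \<one>\<^bsub>G\<^esub> a \<otimes>\<^bsub>A\<^esub> f) g = (\<Oplus>x\<in>carrier G. single \<one>\<^bsub>G\<^esub> a x \<otimes> f (inv\<^bsub>G\<^esub> x \<otimes>\<^bsub>G\<^esub> g))"
    using assms by (simp add: mult_A)
  also have "\<dots> = (\<Oplus>x\<in>{\<one>\<^bsub>G\<^esub>}. single \<one>\<^bsub>G\<^esub> a x \<otimes> f (inv\<^bsub>G\<^esub> x \<otimes>\<^bsub>G\<^esub> g))"
    using assms finite_G
    by (intro add.finprod_mono_neutral_cong_right) (auto simp: single_def)
  also have "\<dots> = a \<otimes> f g" using assms by (simp add: single_def)
  finally show ?thesis .
qed

text \<open>Only the multiplicative structure is recorded, since it determines the unit
  group.\<close>

lemma comm_monoid_A: "comm_monoid A"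
proof (rule comm_monoidI)
  show "\<one>\<^bsub>A\<^esub> \<otimes>\<^bsub>A\<^esub> f = f" if "f \<in> carrier A" for f
    using that by (intro ext_A) (auto simp: one_A single_mult intro: mult_A_closed)
qed (auto simp: one_A mult_A_closed mult_A_assoc intro: mult_A_comm)

lemma card_A: "card (carrier A) = card (carrier R) ^ card (carrier G)"
  by (simp add: carrier_A card_PiE finite_G)

text \<open>The extension of a character \<open>\<chi>\<close> to the group algebra, linear along
  the coefficient map \<open>\<iota>\<close>. For the trivial character and the identity on
  \<open>R\<close> it is the augmentation.\<close>

definition transform :: "('k, 'l) ring_scheme \<Rightarrow> ('a \<Rightarrow> 'k) \<Rightarrow> ('c \<Rightarrow> 'k) \<Rightarrow> ('c \<Rightarrow> 'a) \<Rightarrow> 'k"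
  where "transform K \<iota> \<chi> f = (\<Oplus>\<^bsub>K\<^esub>g\<in>carrier G. \<iota> (f g) \<otimes>\<^bsub>K\<^esub> \<chi> g)"

text \<open>In the transform of a convolution, interchange the sums and replace \<open>g\<close> by
  \<open>x g\<close>; multiplicativity of \<open>\<chi>\<close> then separates the double sum into a
  product. Here \<open>hom G K\<close> refers to the multiplicative monoid of \<open>K\<close>,
  where preservation of the identity is not automatic, hence the assumption on \<open>\<chi>\<close>
  at the identity.\<close>

lemma transform_hom:
  assumes "cring K" and \<iota>: "\<iota> \<in> ring_hom R K" and \<chi>: "\<chi> \<in> hom G K" and \<chi>1: "\<chi> \<one>\<^bsub>G\<^esub> = \<one>\<^bsub>K\<^esub>"
  shows "transform K \<iota> \<chi> \<in> hom A K" "transform K \<iota> \<chi> \<one>\<^bsub>A\<^esub> = \<one>\<^bsub>K\<^esub>"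
proof -
  interpret K: cring K by fact
  interpret \<iota>: ring_hom_cring R K \<iota>
    by unfold_locales (rule \<iota>)
  have \<chi>c [simp, intro]: "\<chi> g \<in> carrier K" if "g \<in> carrier G" for g using \<chi> that by (auto simp: hom_def)
  have \<chi>m: "\<chi> (g \<otimes>\<^bsub>G\<^esub> h) = \<chi> g \<otimes>\<^bsub>K\<^esub> \<chi> h" if "g \<in> carrier G" "h \<in> carrier G" for g h
    using \<chi> that by (auto simp: hom_def)
  \<comment> \<open>Provides translation invariance of sums over \<open>G\<close> with values in
    \<open>K\<close>.\<close>
  interpret K': finite_group_ring K G by unfold_locales (rule finite_G)
  show "transform K \<iota> \<chi> \<in> hom A K"
  proof (rule homI)
    fix f h assume fh [simp]: "f \<in> carrier A" "h \<in> carrier A"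
    have "transform K \<iota> \<chi> (f \<otimes>\<^bsub>A\<^esub> h) = (\<Oplus>\<^bsub>K\<^esub>g\<in>carrier G.
        (\<Oplus>\<^bsub>K\<^esub>x\<in>carrier G. \<iota> (f x) \<otimes>\<^bsub>K\<^esub> \<iota> (h (inv\<^bsub>G\<^esub> x \<otimes>\<^bsub>G\<^esub> g))) \<otimes>\<^bsub>K\<^esub> \<chi> g)"
      unfolding transform_def
    proof (rule K.finsum_cong')
      fix g assume g: "g \<in> carrier G"
      have "\<iota> ((f \<otimes>\<^bsub>A\<^esub> h) g) = (\<Oplus>\<^bsub>K\<^esub>x\<in>carrier G. \<iota> (f x) \<otimes>\<^bsub>K\<^esub> \<iota> (h (inv\<^bsub>G\<^esub> x \<otimes>\<^bsub>G\<^esub> g)))"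
        using g by (simp add: mult_A) (intro K.finsum_cong', auto)
      then show "\<iota> ((f \<otimes>\<^bsub>A\<^esub> h) g) \<otimes>\<^bsub>K\<^esub> \<chi> g = (\<Oplus>\<^bsub>K\<^esub>x\<in>carrier G. \<iota> (f x) \<otimes>\<^bsub>K\<^esub> \<iota> (h (inv\<^bsub>G\<^esub> x \<otimes>\<^bsub>G\<^esub> g))) \<otimes>\<^bsub>K\<^esub> \<chi> g"
        by simp
    qed (auto intro!: K.finsum_closed K.m_closed)
    also have "\<dots> = (\<Oplus>\<^bsub>K\<^esub>g\<in>carrier G. \<Oplus>\<^bsub>K\<^esub>x\<in>carrier G. \<iota> (f x) \<otimes>\<^bsub>K\<^esub> \<iota> (h (inv\<^bsub>G\<^esub> x \<otimes>\<^bsub>G\<^esub> g)) \<otimes>\<^bsub>K\<^esub> \<chi> g)"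
      by (intro K.finsum_cong' K.finsum_ldistr) (auto simp: finite_G intro!: K.finsum_closed)
    also have "\<dots> = (\<Oplus>\<^bsub>K\<^esub>x\<in>carrier G. \<Oplus>\<^bsub>K\<^esub>g\<in>carrier G. \<iota> (f x) \<otimes>\<^bsub>K\<^esub> \<iota> (h (inv\<^bsub>G\<^esub> x \<otimes>\<^bsub>G\<^esub> g)) \<otimes>\<^bsub>K\<^esub> \<chi> g)"
      by (intro K.add.finprod_swap) (auto simp: finite_G)
    also have "\<dots> = (\<Oplus>\<^bsub>K\<^esub>x\<in>carrier G. \<iota> (f x) \<otimes>\<^bsub>K\<^esub> \<chi> x \<otimes>\<^bsub>K\<^esub> transform K \<iota> \<chi> h)"
    proof (rule K.finsum_cong')
      fix x assume x: "x \<in> carrier G"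
      have "(\<Oplus>\<^bsub>K\<^esub>g\<in>carrier G. \<iota> (f x) \<otimes>\<^bsub>K\<^esub> \<iota> (h (inv\<^bsub>G\<^esub> x \<otimes>\<^bsub>G\<^esub> g)) \<otimes>\<^bsub>K\<^esub> \<chi> g)
          = (\<Oplus>\<^bsub>K\<^esub>g\<in>carrier G. \<iota> (f x) \<otimes>\<^bsub>K\<^esub> \<iota> (h (inv\<^bsub>G\<^esub> x \<otimes>\<^bsub>G\<^esub> (x \<otimes>\<^bsub>G\<^esub> g))) \<otimes>\<^bsub>K\<^esub> \<chi> (x \<otimes>\<^bsub>G\<^esub> g))"
        using x by (subst K'.finsum_translate[OF x]) auto
      also have "\<dots> = (\<Oplus>\<^bsub>K\<^esub>g\<in>carrier G. \<iota> (f x) \<otimes>\<^bsub>K\<^esub> \<chi> x \<otimes>\<^bsub>K\<^esub> (\<iota> (h g) \<otimes>\<^bsub>K\<^esub> \<chi> g))"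
        using x by (intro K.finsum_cong') (auto simp: \<chi>m K.m_ac inv_mult_cancel)
      also have "\<dots> = \<iota> (f x) \<otimes>\<^bsub>K\<^esub> \<chi> x \<otimes>\<^bsub>K\<^esub> transform K \<iota> \<chi> h"
        unfolding transform_def using x by (intro K.finsum_rdistr[symmetric]) (auto simp: finite_G)
      finally show "(\<Oplus>\<^bsub>K\<^esub>g\<in>carrier G. \<iota> (f x) \<otimes>\<^bsub>K\<^esub> \<iota> (h (inv\<^bsub>G\<^esub> x \<otimes>\<^bsub>G\<^esub> g)) \<otimes>\<^bsub>K\<^esub> \<chi> g) = \<dots>" .
    qed (auto simp: transform_def intro!: K.finsum_closed)
    also have "\<dots> = transform K \<iota> \<chi> f \<otimes>\<^bsub>K\<^esub> transform K \<iota> \<chi> h"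
      unfolding transform_def by (intro K.finsum_ldistr[symmetric]) (auto simp: finite_G intro!: K.finsum_closed)
    finally show "transform K \<iota> \<chi> (f \<otimes>\<^bsub>A\<^esub> h) = \<dots>" .
  qed (auto simp: transform_def intro!: K.finsum_closed)
  have "transform K \<iota> \<chi> \<one>\<^bsub>A\<^esub> = (\<Oplus>\<^bsub>K\<^esub>g\<in>{\<one>\<^bsub>G\<^esub>}. \<iota> (\<one>\<^bsub>A\<^esub> g) \<otimes>\<^bsub>K\<^esub> \<chi> g)"
    unfolding transform_def using finite_G
    by (intro K.add.finprod_mono_neutral_cong_right) (auto simp: one_A single_def)
  also have "\<dots> = \<one>\<^bsub>K\<^esub>" by (simp add: one_A single_def \<chi>1)
  finally show "transform K \<iota> \<chi> \<one>\<^bsub>A\<^esub> = \<one>\<^bsub>K\<^esub>" .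
qed

end

section \<open>Splitting by characters\<close>

text \<open>The family \<open>\<chi>\<close> embeds \<open>A\<close> into the product of the
  \<open>K j\<close>, and equal cardinalities make the embedding onto. A bijective monoid
  homomorphism carries units to units in both directions, and the units of a product are the
  families of units.\<close>

lemma units_iso_product_group:
  assumes A: "comm_monoid A" and finA: "finite (carrier A)"
    and J: "finite J" and K: "\<And>j. j \<in> J \<Longrightarrow> comm_monoid (K j)"
    and hom: "\<And>j. j \<in> J \<Longrightarrow> \<chi> j \<in> hom A (K j)" and one: "\<And>j. j \<in> J \<Longrightarrow> \<chi> j \<one>\<^bsub>A\<^esub> = \<one>\<^bsub>K j\<^esub>"
    and inj: "\<And>f h. f \<in> carrier A \<Longrightarrow> h \<in> carrier A \<Longrightarrow> (\<And>j. j \<in> J \<Longrightarrow> \<chi> j f = \<chi> j h) \<Longrightarrow> f = h"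
    and card: "card (carrier A) = (\<Prod>j\<in>J. card (carrier (K j)))"
  shows "units_of A \<cong> product_group J (\<lambda>j. units_of (K j))"
proof -
  interpret A: comm_monoid A by fact
  let ?\<Phi> = "\<lambda>f. \<lambda>j\<in>J. \<chi> j f"
  let ?P = "\<Pi>\<^sub>E j\<in>J. carrier (K j)"
  have \<chi>: "\<chi> j f \<in> carrier (K j)" if "j \<in> J" "f \<in> carrier A" for j f
    using hom that by (auto simp: hom_def)
  have mult: "\<chi> j (f \<otimes>\<^bsub>A\<^esub> h) = \<chi> j f \<otimes>\<^bsub>K j\<^esub> \<chi> j h" if "j \<in> J" "f \<in> carrier A" "h \<in> carrier A" for j f h
    using hom that by (auto simp: hom_def)
  have inj\<Phi>: "inj_on ?\<Phi> (carrier A)"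
  proof (rule inj_onI)
    fix f h assume fh: "f \<in> carrier A" "h \<in> carrier A" "?\<Phi> f = ?\<Phi> h"
    show "f = h"
    proof (rule inj[OF fh(1,2)])
      show "\<chi> j f = \<chi> j h" if "j \<in> J" for j using fun_cong[OF fh(3), of j] that by simp
    qed
  qed
  have surj: "?\<Phi> ` carrier A = ?P"
  proof (rule card_subset_eq)
    have cP: "card ?P = card (carrier A)" using card J by (simp add: card_PiE)
    have "card (carrier A) > 0" using finA A.one_closed by (auto simp: card_gt_0_iff)
    then show "finite ?P" using cP by (metis card_gt_0_iff)
    show "?\<Phi> ` carrier A \<subseteq> ?P" using \<chi> by auto
    show "card (?\<Phi> ` carrier A) = card ?P" using cP inj\<Phi> by (simp add: card_image)
  qed
  have homU: "?\<Phi> \<in> hom (units_of A) (product_group J (\<lambda>j. units_of (K j)))"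
  proof (rule homI)
    fix u assume u: "u \<in> carrier (units_of A)"
    then have u': "u \<in> Units A" by (simp add: units_of_carrier)
    have "\<chi> j u \<in> Units (K j)" if j: "j \<in> J" for j
    proof -
      interpret K: comm_monoid "K j" by (rule K[OF j])
      have "\<chi> j u \<otimes>\<^bsub>K j\<^esub> \<chi> j (inv\<^bsub>A\<^esub> u) = \<one>\<^bsub>K j\<^esub>"
        using mult[OF j, of u "inv\<^bsub>A\<^esub> u"] u' A.Units_closed[OF u'] by (simp add: one[OF j])
      moreover have "\<chi> j (inv\<^bsub>A\<^esub> u) \<in> carrier (K j)" "\<chi> j u \<in> carrier (K j)" using \<chi> j u' by auto
      ultimately show ?thesis unfolding Units_def by (auto simp: K.m_comm intro!: bexI)
    qed
    then show "?\<Phi> u \<in> carrier (product_group J (\<lambda>j. units_of (K j)))"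
      by (simp add: units_of_carrier)
  next
    fix u v assume "u \<in> carrier (units_of A)" "v \<in> carrier (units_of A)"
    then show "?\<Phi> (u \<otimes>\<^bsub>units_of A\<^esub> v) = ?\<Phi> u \<otimes>\<^bsub>product_group J (\<lambda>j. units_of (K j))\<^esub> ?\<Phi> v"
      by (auto simp: units_of_carrier units_of_mult mult A.Units_closed fun_eq_iff)
  qed
  have "bij_betw ?\<Phi> (carrier (units_of A)) (carrier (product_group J (\<lambda>j. units_of (K j))))"
    unfolding bij_betw_def
  proof
    show "inj_on ?\<Phi> (carrier (units_of A))"
      using inj\<Phi> by (rule inj_on_subset) (auto simp: units_of_carrier)
    show "?\<Phi> ` carrier (units_of A) = carrier (product_group J (\<lambda>j. units_of (K j)))"
    proof
      show "?\<Phi> ` carrier (units_of A) \<subseteq> carrier (product_group J (\<lambda>j. units_of (K j)))"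
        using homU by (auto simp: hom_def)
      show "carrier (product_group J (\<lambda>j. units_of (K j))) \<subseteq> ?\<Phi> ` carrier (units_of A)"
      proof
        fix x assume "x \<in> carrier (product_group J (\<lambda>j. units_of (K j)))"
        then have x: "x j \<in> Units (K j)" if "j \<in> J" for j
          using that by (auto simp: units_of_carrier PiE_iff)
        have xe: "x \<in> extensional J"
          using \<open>x \<in> carrier (product_group J (\<lambda>j. units_of (K j)))\<close> by (auto simp: PiE_iff)
        \<comment> \<open>A family of units is lifted together with the family of inverses. The
          lifts \<open>f\<close> and \<open>h\<close> are mutually inverse, because joint
          injectivity allows \<open>f h = 1\<close> to be tested in each factor.\<close>
        let ?y = "\<lambda>j\<in>J. inv\<^bsub>K j\<^esub> x j"
        have m: "monoid (K j)" if "j \<in> J" for j using K[OF that] by (simp add: comm_monoid.axioms(1))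
        have "x \<in> ?P" using x xe m by (auto simp: PiE_iff monoid.Units_closed)
        moreover have "?y \<in> ?P" using x m by (auto simp: PiE_iff monoid.Units_inv_closed)
        ultimately obtain f h where fh: "f \<in> carrier A" "h \<in> carrier A" "?\<Phi> f = x" "?\<Phi> h = ?y"
          using surj by (metis (no_types, lifting) imageE)
        have "f \<otimes>\<^bsub>A\<^esub> h = \<one>\<^bsub>A\<^esub>"
        proof (rule inj)
          fix j assume j: "j \<in> J"
          have "\<chi> j f = x j" "\<chi> j h = inv\<^bsub>K j\<^esub> x j" using fh(3,4)[THEN fun_cong, of j] j by simp_all
          then show "\<chi> j (f \<otimes>\<^bsub>A\<^esub> h) = \<chi> j \<one>\<^bsub>A\<^esub>"
            using mult[OF j] fh one[OF j] x j m by (simp add: monoid.Units_r_inv)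
        qed (use fh in auto)
        then have "f \<in> Units A" using fh A.m_comm by (auto simp: Units_def intro!: bexI[of _ h])
        then show "x \<in> ?\<Phi> ` carrier (units_of A)" using fh by (auto simp: units_of_carrier)
      qed
    qed
  qed
  then show ?thesis using homU by (blast intro: is_isoI isoI)
qed

section \<open>Adjoining a square root of -1\<close>

text \<open>Taking the zero ideal for \<open>S\<close> gives a copy of \<open>R\<close> inside \<open>R[i]\<close>.\<close>

definition gaussian :: "('a, 'b) ring_scheme \<Rightarrow> 'a set \<Rightarrow> ('a \<times> 'a) ring"
  where "gaussian R S =
    \<lparr>carrier = carrier R \<times> S,
     monoid.mult = (\<lambda>(a, b) (c, d). (a \<otimes>\<^bsub>R\<^esub> c \<ominus>\<^bsub>R\<^esub> b \<otimes>\<^bsub>R\<^esub> d, a \<otimes>\<^bsub>R\<^esub> d \<oplus>\<^bsub>R\<^esub> b \<otimes>\<^bsub>R\<^esub> c)),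
     one = (\<one>\<^bsub>R\<^esub>, \<zero>\<^bsub>R\<^esub>),
     ring.zero = (\<zero>\<^bsub>R\<^esub>, \<zero>\<^bsub>R\<^esub>),
     ring.add = (\<lambda>(a, b) (c, d). (a \<oplus>\<^bsub>R\<^esub> c, b \<oplus>\<^bsub>R\<^esub> d))\<rparr>"

lemma gaussian_simps [simp]:
  "carrier (gaussian R S) = carrier R \<times> S"
  "(a, b) \<otimes>\<^bsub>gaussian R S\<^esub> (c, d) = (a \<otimes>\<^bsub>R\<^esub> c \<ominus>\<^bsub>R\<^esub> b \<otimes>\<^bsub>R\<^esub> d, a \<otimes>\<^bsub>R\<^esub> d \<oplus>\<^bsub>R\<^esub> b \<otimes>\<^bsub>R\<^esub> c)"
  "(a, b) \<oplus>\<^bsub>gaussian R S\<^esub> (c, d) = (a \<oplus>\<^bsub>R\<^esub> c, b \<oplus>\<^bsub>R\<^esub> d)"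
  "\<one>\<^bsub>gaussian R S\<^esub> = (\<one>\<^bsub>R\<^esub>, \<zero>\<^bsub>R\<^esub>)"
  "\<zero>\<^bsub>gaussian R S\<^esub> = (\<zero>\<^bsub>R\<^esub>, \<zero>\<^bsub>R\<^esub>)"
  by (simp_all add: gaussian_def)

text \<open>The ideal property is what closes the carrier under multiplication: the imaginary part
  \<open>a d + b c\<close> stays in \<open>S\<close> when \<open>b\<close> and \<open>d\<close> do.
  Both the full ring and the zero ideal are instances.\<close>

lemma cring_gaussian:
  assumes "cring R" "ideal S R"
  shows "cring (gaussian R S)"
proof -
  interpret cring R by fact
  interpret I: ideal S R by fact
  have S [simp]: "x \<in> carrier R" if "x \<in> S" for x using that I.a_subset by auto
  have [simp]: "\<zero>\<^bsub>R\<^esub> \<in> S" by (rule I.zero_closed)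
  note cl = I.I_l_closed I.I_r_closed I.a_closed I.a_inv_closed
  show ?thesis
  proof (rule cringI)
    show "abelian_group (gaussian R S)"
    proof (rule abelian_groupI)
      fix x assume "x \<in> carrier (gaussian R S)"
      then obtain a b where "x = (a, b)" "a \<in> carrier R" "b \<in> S" by auto
      then show "\<exists>y\<in>carrier (gaussian R S). y \<oplus>\<^bsub>gaussian R S\<^esub> x = \<zero>\<^bsub>gaussian R S\<^esub>"
        by (intro bexI[of _ "(\<ominus>\<^bsub>R\<^esub> a, \<ominus>\<^bsub>R\<^esub> b)"]) (auto simp: cl l_neg)
    qed (auto simp: cl a_ac)
    show "comm_monoid (gaussian R S)"
    proof (rule comm_monoidI)
      fix x y z
      assume "x \<in> carrier (gaussian R S)" "y \<in> carrier (gaussian R S)" "z \<in> carrier (gaussian R S)"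
      then obtain a b c d e f where x: "x = (a, b)" "y = (c, d)" "z = (e, f)"
        and [simp]: "a \<in> carrier R" "b \<in> carrier R" "c \<in> carrier R" "d \<in> carrier R" "e \<in> carrier R" "f \<in> carrier R"
        by auto
      show "x \<otimes>\<^bsub>gaussian R S\<^esub> y \<otimes>\<^bsub>gaussian R S\<^esub> z = x \<otimes>\<^bsub>gaussian R S\<^esub> (y \<otimes>\<^bsub>gaussian R S\<^esub> z)"
        unfolding x gaussian_simps prod.inject by (simp add: minus_eq l_distr r_distr l_minus r_minus minus_add m_assoc a_ac)
    next
      fix x y
      assume "x \<in> carrier (gaussian R S)" "y \<in> carrier (gaussian R S)"
      then obtain a b c d where x: "x = (a, b)" "y = (c, d)"
        and [simp]: "a \<in> carrier R" "b \<in> carrier R" "c \<in> carrier R" "d \<in> carrier R"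
        by auto
      show "x \<otimes>\<^bsub>gaussian R S\<^esub> y = y \<otimes>\<^bsub>gaussian R S\<^esub> x"
        unfolding x gaussian_simps prod.inject by (simp add: m_comm a_comm)
    next
      fix x y
      assume "x \<in> carrier (gaussian R S)" "y \<in> carrier (gaussian R S)"
      then show "x \<otimes>\<^bsub>gaussian R S\<^esub> y \<in> carrier (gaussian R S)" by (auto simp: cl)
    next
      fix x assume "x \<in> carrier (gaussian R S)"
      then show "\<one>\<^bsub>gaussian R S\<^esub> \<otimes>\<^bsub>gaussian R S\<^esub> x = x" by (auto simp: minus_eq)
    qed simp
    fix x y z
    assume "x \<in> carrier (gaussian R S)" "y \<in> carrier (gaussian R S)" "z \<in> carrier (gaussian R S)"
    then obtain a b c d e f where x: "x = (a, b)" "y = (c, d)" "z = (e, f)"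
      and [simp]: "a \<in> carrier R" "b \<in> carrier R" "c \<in> carrier R" "d \<in> carrier R" "e \<in> carrier R" "f \<in> carrier R"
      by auto
    show "(x \<oplus>\<^bsub>gaussian R S\<^esub> y) \<otimes>\<^bsub>gaussian R S\<^esub> z
        = x \<otimes>\<^bsub>gaussian R S\<^esub> z \<oplus>\<^bsub>gaussian R S\<^esub> y \<otimes>\<^bsub>gaussian R S\<^esub> z"
      unfolding x gaussian_simps prod.inject by (simp add: minus_eq l_distr minus_add a_ac)
  qed
qed

text \<open>The inverse of \<open>a + b i\<close> is \<open>(a - b i) / (a^2 + b^2)\<close>. The
  norm in the denominator cannot vanish for a nonzero element, since otherwise \<open>b\<close> is
  nonzero and \<open>a / b\<close> is a square root of -1.\<close>

lemma field_gaussian: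
  assumes "field R" "ideal S R" and nosqrt: "\<And>a. a \<in> carrier R \<Longrightarrow> a \<otimes>\<^bsub>R\<^esub> a \<noteq> \<ominus>\<^bsub>R\<^esub> \<one>\<^bsub>R\<^esub>"
  shows "field (gaussian R S)"
proof -
  interpret field R by fact
  interpret I: ideal S R by fact
  interpret C: cring "gaussian R S" by (rule cring_gaussian) (fact is_cring, fact assms(2))
  have S [simp]: "x \<in> carrier R" if "x \<in> S" for x using that I.a_subset by auto
  have "\<exists>y\<in>carrier (gaussian R S). x \<otimes>\<^bsub>gaussian R S\<^esub> y = \<one>\<^bsub>gaussian R S\<^esub>"
    if x: "x \<in> carrier (gaussian R S)" "x \<noteq> \<zero>\<^bsub>gaussian R S\<^esub>" for x
  proof -
    obtain a b where ab: "x = (a, b)" "a \<in> carrier R" "b \<in> S" using x by auto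
    then have b [simp]: "a \<in> carrier R" "b \<in> carrier R" by auto
    let ?N = "a \<otimes>\<^bsub>R\<^esub> a \<oplus>\<^bsub>R\<^esub> b \<otimes>\<^bsub>R\<^esub> b"
    have N: "?N \<noteq> \<zero>\<^bsub>R\<^esub>"
    proof
      assume N: "?N = \<zero>\<^bsub>R\<^esub>"
      show False
      proof (cases "b = \<zero>\<^bsub>R\<^esub>")
        case True
        then show False using N x ab by (simp add: integral_iff)
      next
        case False
        then have u: "b \<in> Units R" by (simp add: field_Units)
        let ?c = "inv\<^bsub>R\<^esub> b"
        have c [simp]: "?c \<in> carrier R" using u by simp
        have bc: "b \<otimes>\<^bsub>R\<^esub> ?c = \<one>\<^bsub>R\<^esub>" using u by simp
        \<comment> \<open>The identity is arranged so that substituting \<open>?N = 0\<close> and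
          \<open>b ?c = 1\<close> leaves -1 on the right.\<close>
        have "(a \<otimes>\<^bsub>R\<^esub> ?c) \<otimes>\<^bsub>R\<^esub> (a \<otimes>\<^bsub>R\<^esub> ?c) = ?N \<otimes>\<^bsub>R\<^esub> (?c \<otimes>\<^bsub>R\<^esub> ?c) \<ominus>\<^bsub>R\<^esub> (b \<otimes>\<^bsub>R\<^esub> ?c) \<otimes>\<^bsub>R\<^esub> (b \<otimes>\<^bsub>R\<^esub> ?c)"
          using b c by algebra
        also have "\<dots> = \<ominus>\<^bsub>R\<^esub> \<one>\<^bsub>R\<^esub>" unfolding N bc by (simp add: minus_eq)
        finally show False using nosqrt[of "a \<otimes>\<^bsub>R\<^esub> ?c"] by simp
      qed
    qed
    then have u: "?N \<in> Units R" by (simp add: field_Units)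
    let ?m = "inv\<^bsub>R\<^esub> ?N"
    have m [simp]: "?m \<in> carrier R" using u by simp
    have Nm: "?N \<otimes>\<^bsub>R\<^esub> ?m = \<one>\<^bsub>R\<^esub>" using u by simp
    show ?thesis
    proof
      show "(a \<otimes>\<^bsub>R\<^esub> ?m, \<ominus>\<^bsub>R\<^esub> b \<otimes>\<^bsub>R\<^esub> ?m) \<in> carrier (gaussian R S)"
        using ab by (auto intro: I.I_r_closed I.a_inv_closed)
      have "a \<otimes>\<^bsub>R\<^esub> (a \<otimes>\<^bsub>R\<^esub> ?m) \<ominus>\<^bsub>R\<^esub> b \<otimes>\<^bsub>R\<^esub> (\<ominus>\<^bsub>R\<^esub> b \<otimes>\<^bsub>R\<^esub> ?m) = ?N \<otimes>\<^bsub>R\<^esub> ?m"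
        using b m by algebra
      moreover have "a \<otimes>\<^bsub>R\<^esub> (\<ominus>\<^bsub>R\<^esub> b \<otimes>\<^bsub>R\<^esub> ?m) \<oplus>\<^bsub>R\<^esub> b \<otimes>\<^bsub>R\<^esub> (a \<otimes>\<^bsub>R\<^esub> ?m) = \<zero>\<^bsub>R\<^esub>"
        using b m by algebra
      ultimately show "x \<otimes>\<^bsub>gaussian R S\<^esub> (a \<otimes>\<^bsub>R\<^esub> ?m, \<ominus>\<^bsub>R\<^esub> b \<otimes>\<^bsub>R\<^esub> ?m) = \<one>\<^bsub>gaussian R S\<^esub>"
        unfolding ab(1) gaussian_simps Nm by simp
    qed
  qed
  then have "Units (gaussian R S) = carrier (gaussian R S) - {\<zero>\<^bsub>gaussian R S\<^esub>}"
  proof (intro equalityI subsetI)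
    fix x assume x: "x \<in> Units (gaussian R S)"
    have "x \<noteq> \<zero>\<^bsub>gaussian R S\<^esub>"
    proof
      assume "x = \<zero>\<^bsub>gaussian R S\<^esub>"
      then have "\<zero>\<^bsub>gaussian R S\<^esub> = \<one>\<^bsub>gaussian R S\<^esub>"
        using C.Units_r_inv[OF x] C.l_null[OF C.Units_inv_closed[OF x]] by simp
      then show False by simp
    qed
    then show "x \<in> carrier (gaussian R S) - {\<zero>\<^bsub>gaussian R S\<^esub>}" using C.Units_closed[OF x] by blast
  next
    fix x assume x: "x \<in> carrier (gaussian R S) - {\<zero>\<^bsub>gaussian R S\<^esub>}"
      and inv: "\<And>x. x \<in> carrier (gaussian R S) \<Longrightarrow> x \<noteq> \<zero>\<^bsub>gaussian R S\<^esub> \<Longrightarrow>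
        \<exists>y\<in>carrier (gaussian R S). x \<otimes>\<^bsub>gaussian R S\<^esub> y = \<one>\<^bsub>gaussian R S\<^esub>"
    then obtain y where "y \<in> carrier (gaussian R S)" "x \<otimes>\<^bsub>gaussian R S\<^esub> y = \<one>\<^bsub>gaussian R S\<^esub>" by blast
    moreover from this have "y \<otimes>\<^bsub>gaussian R S\<^esub> x = \<one>\<^bsub>gaussian R S\<^esub>" using x C.m_comm by (metis DiffD1)
    ultimately show "x \<in> Units (gaussian R S)" using x unfolding Units_def by blast
  qed
  then show ?thesis by (rule C.cring_fieldI)
qed

section \<open>Orthogonality of characters and Fourier inversion\<close>

text \<open>Multiplying the sum by \<open>\<chi> a\<close> only permutes its terms, so
  \<open>\<chi> a - 1\<close> times the sum is zero, and a domain has no zero divisors.\<close>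

lemma (in finite_group_ring) character_sum_zero:
  assumes "domain K" and \<chi>: "\<chi> \<in> hom G K" and a: "a \<in> carrier G" "\<chi> a \<noteq> \<one>\<^bsub>K\<^esub>"
  shows "(\<Oplus>\<^bsub>K\<^esub>g\<in>carrier G. \<chi> g) = \<zero>\<^bsub>K\<^esub>"
proof -
  interpret K: domain K by fact
  interpret K': finite_group_ring K G by unfold_locales (rule finite_G)
  have \<chi>c [simp, intro]: "\<chi> g \<in> carrier K" if "g \<in> carrier G" for g
    using \<chi> that by (auto simp: hom_def)
  let ?S = "\<Oplus>\<^bsub>K\<^esub>g\<in>carrier G. \<chi> g"
  have S: "?S \<in> carrier K" by (intro K.finsum_closed) auto
  have "\<chi> a \<otimes>\<^bsub>K\<^esub> ?S = (\<Oplus>\<^bsub>K\<^esub>g\<in>carrier G. \<chi> a \<otimes>\<^bsub>K\<^esub> \<chi> g)"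
    using a by (intro K.finsum_rdistr) (auto simp: finite_G)
  also have "\<dots> = (\<Oplus>\<^bsub>K\<^esub>g\<in>carrier G. \<chi> (a \<otimes>\<^bsub>G\<^esub> g))"
    using a \<chi> by (intro K.finsum_cong') (auto simp: hom_def)
  also have "\<dots> = ?S" using a by (intro K'.finsum_translate) auto
  finally have "(\<chi> a \<ominus>\<^bsub>K\<^esub> \<one>\<^bsub>K\<^esub>) \<otimes>\<^bsub>K\<^esub> ?S = \<zero>\<^bsub>K\<^esub>"
    using a S by (simp add: K.minus_eq K.l_distr K.l_minus K.r_neg)
  moreover have "\<chi> a \<ominus>\<^bsub>K\<^esub> \<one>\<^bsub>K\<^esub> \<noteq> \<zero>\<^bsub>K\<^esub>" using a by simp
  ultimately show ?thesis using K.integral_iff S a by simp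
qed

text \<open>The second argument \<open>h\<close> indexes the characters
  \<open>g \<mapsto> \<beta> g h\<close>. Multiplicativity in \<open>h\<close> makes it possible to
  sum over all these characters at a fixed \<open>g\<close>. The field of values \<open>K\<close> is
  kept apart from the coefficients \<open>R\<close>, because a primitive fourth root of unity may
  exist only in the extension.\<close>

locale bicharacter = finite_group_ring R G + K: domain K
  for R (structure) and G (structure) and K (structure) +
  fixes \<iota> \<beta>
  assumes \<iota>_hom: "\<iota> \<in> ring_hom R K"
    and \<iota>_inj: "inj_on \<iota> (carrier R)"
    and \<beta>_closed [simp, intro]: "\<And>g h. g \<in> carrier G \<Longrightarrow> h \<in> carrier G \<Longrightarrow> \<beta> g h \<in> carrier K"
    and \<beta>_mult_left: "\<And>g g' h. g \<in> carrier G \<Longrightarrow> g' \<in> carrier G \<Longrightarrow> h \<in> carrier G \<Longrightarrow>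
      \<beta> (g \<otimes>\<^bsub>G\<^esub> g') h = \<beta> g h \<otimes>\<^bsub>K\<^esub> \<beta> g' h"
    and \<beta>_mult_right: "\<And>g h h'. g \<in> carrier G \<Longrightarrow> h \<in> carrier G \<Longrightarrow> h' \<in> carrier G \<Longrightarrow>
      \<beta> g (h \<otimes>\<^bsub>G\<^esub> h') = \<beta> g h \<otimes>\<^bsub>K\<^esub> \<beta> g h'"
    and \<beta>_one_left: "\<And>h. h \<in> carrier G \<Longrightarrow> \<beta> \<one>\<^bsub>G\<^esub> h = \<one>\<^bsub>K\<^esub>"
    and nondegenerate: "\<And>g. g \<in> carrier G \<Longrightarrow> g \<noteq> \<one>\<^bsub>G\<^esub> \<Longrightarrow> \<exists>h\<in>carrier G. \<beta> g h \<noteq> \<one>\<^bsub>K\<^esub>"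
    and card_nonzero: "[card (carrier G)] \<cdot>\<^bsub>K\<^esub> \<one>\<^bsub>K\<^esub> \<noteq> \<zero>\<^bsub>K\<^esub>"
begin

lemma \<iota>_closed [simp, intro]: "a \<in> carrier R \<Longrightarrow> \<iota> a \<in> carrier K"
  using \<iota>_hom by (auto simp: ring_hom_def)

abbreviation "hat h \<equiv> transform K \<iota> (\<lambda>g. \<beta> g h)"

lemma hat_hom:
  assumes "h \<in> carrier G"
  shows "hat h \<in> hom A K" "hat h \<one>\<^bsub>A\<^esub> = \<one>\<^bsub>K\<^esub>"
  using transform_hom[OF K.is_cring \<iota>_hom, of "\<lambda>g. \<beta> g h"] assms
  by (auto simp: hom_def \<beta>_mult_left \<beta>_one_left)

text \<open>For fixed \<open>g\<close> the map \<open>h \<mapsto> \<beta> g h\<close> is itself a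
  character of \<open>G\<close>, and nondegeneracy says that it is nontrivial unless
  \<open>g\<close> is the identity.\<close>

lemma orthogonality:
  assumes "g \<in> carrier G"
  shows "(\<Oplus>\<^bsub>K\<^esub>h\<in>carrier G. \<beta> g h) = (if g = \<one>\<^bsub>G\<^esub> then [card (carrier G)] \<cdot>\<^bsub>K\<^esub> \<one>\<^bsub>K\<^esub> else \<zero>\<^bsub>K\<^esub>)"
proof (cases "g = \<one>\<^bsub>G\<^esub>")
  case True
  have "(\<Oplus>\<^bsub>K\<^esub>h\<in>carrier G. \<beta> g h) = (\<Oplus>\<^bsub>K\<^esub>h\<in>carrier G. \<one>\<^bsub>K\<^esub>)"
    using True by (intro K.finsum_cong') (auto simp: \<beta>_one_left)
  then show ?thesis using True K.add.finprod_const[of "\<one>\<^bsub>K\<^esub>" "carrier G"] by simp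
next
  case False
  then obtain a where "a \<in> carrier G" "\<beta> g a \<noteq> \<one>\<^bsub>K\<^esub>" using nondegenerate assms by blast
  moreover have "\<beta> g \<in> hom G K" using assms by (auto simp: hom_def \<beta>_mult_right)
  ultimately show ?thesis using False character_sum_zero[OF K.domain_axioms] by simp
qed

text \<open>Bilinearity combines the two values of \<open>\<beta>\<close> into one at
  \<open>x^-1 g\<close>, so by orthogonality only the term \<open>g = x\<close> survives. The group
  order is left as a factor on the right; being nonzero in a domain, it can be cancelled
  later.\<close>

lemma fourier_inversion:
  assumes f: "f \<in> carrier A" and x: "x \<in> carrier G"
  shows "(\<Oplus>\<^bsub>K\<^esub>h\<in>carrier G. \<beta> (inv\<^bsub>G\<^esub> x) h \<otimes>\<^bsub>K\<^esub> hat h f) = \<iota> (f x) \<otimes>\<^bsub>K\<^esub> [card (carrier G)] \<cdot>\<^bsub>K\<^esub> \<one>\<^bsub>K\<^esub>"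
proof -
  let ?n = "[card (carrier G)] \<cdot>\<^bsub>K\<^esub> \<one>\<^bsub>K\<^esub>"
  have "(\<Oplus>\<^bsub>K\<^esub>h\<in>carrier G. \<beta> (inv\<^bsub>G\<^esub> x) h \<otimes>\<^bsub>K\<^esub> hat h f)
    = (\<Oplus>\<^bsub>K\<^esub>h\<in>carrier G. \<Oplus>\<^bsub>K\<^esub>g\<in>carrier G. \<beta> (inv\<^bsub>G\<^esub> x) h \<otimes>\<^bsub>K\<^esub> (\<iota> (f g) \<otimes>\<^bsub>K\<^esub> \<beta> g h))"
    unfolding transform_def using f x
    by (intro K.finsum_cong' K.finsum_rdistr) (auto simp: finite_G intro!: K.finsum_closed)
  also have "\<dots> = (\<Oplus>\<^bsub>K\<^esub>g\<in>carrier G. \<Oplus>\<^bsub>K\<^esub>h\<in>carrier G. \<beta> (inv\<^bsub>G\<^esub> x) h \<otimes>\<^bsub>K\<^esub> (\<iota> (f g) \<otimes>\<^bsub>K\<^esub> \<beta> g h))"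
    using f x by (intro K.add.finprod_swap) (auto simp: finite_G)
  also have "\<dots> = (\<Oplus>\<^bsub>K\<^esub>g\<in>carrier G. if x = g then \<iota> (f g) \<otimes>\<^bsub>K\<^esub> ?n else \<zero>\<^bsub>K\<^esub>)"
  proof (rule K.finsum_cong')
    fix g assume g: "g \<in> carrier G"
    have "(\<Oplus>\<^bsub>K\<^esub>h\<in>carrier G. \<beta> (inv\<^bsub>G\<^esub> x) h \<otimes>\<^bsub>K\<^esub> (\<iota> (f g) \<otimes>\<^bsub>K\<^esub> \<beta> g h))
        = (\<Oplus>\<^bsub>K\<^esub>h\<in>carrier G. \<iota> (f g) \<otimes>\<^bsub>K\<^esub> \<beta> (inv\<^bsub>G\<^esub> x \<otimes>\<^bsub>G\<^esub> g) h)"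
      using f x g by (intro K.finsum_cong') (auto simp: \<beta>_mult_left K.m_lcomm)
    also have "\<dots> = \<iota> (f g) \<otimes>\<^bsub>K\<^esub> (\<Oplus>\<^bsub>K\<^esub>h\<in>carrier G. \<beta> (inv\<^bsub>G\<^esub> x \<otimes>\<^bsub>G\<^esub> g) h)"
      using f x g by (intro K.finsum_rdistr[symmetric]) (auto simp: finite_G)
    also have "\<dots> = (if x = g then \<iota> (f g) \<otimes>\<^bsub>K\<^esub> ?n else \<zero>\<^bsub>K\<^esub>)"
    proof (cases "x = g")
      case True
      then show ?thesis using f x g by (simp add: orthogonality)
    next
      case False
      then have "inv\<^bsub>G\<^esub> x \<otimes>\<^bsub>G\<^esub> g \<noteq> \<one>\<^bsub>G\<^esub>" using x g by (metis G.inv_equality G.inv_inv G.inv_closed G.m_comm)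
      then show ?thesis using False f x g by (simp add: orthogonality)
    qed
    finally show "(\<Oplus>\<^bsub>K\<^esub>h\<in>carrier G. \<beta> (inv\<^bsub>G\<^esub> x) h \<otimes>\<^bsub>K\<^esub> (\<iota> (f g) \<otimes>\<^bsub>K\<^esub> \<beta> g h)) = \<dots>" .
  qed (use f in auto)
  also have "\<dots> = \<iota> (f x) \<otimes>\<^bsub>K\<^esub> ?n"
    using f x by (intro K.add.finprod_singleton) (auto simp: finite_G)
  finally show ?thesis .
qed

lemma hat_jointly_inj:
  assumes f: "f \<in> carrier A" "f' \<in> carrier A"
    and eq: "\<And>h. h \<in> carrier G \<Longrightarrow> hat h f = hat h f'"
  shows "f = f'"
proof (rule ext_A[OF f])
  fix x assume x: "x \<in> carrier G"
  have "(\<Oplus>\<^bsub>K\<^esub>h\<in>carrier G. \<beta> (inv\<^bsub>G\<^esub> x) h \<otimes>\<^bsub>K\<^esub> hat h f)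
      = (\<Oplus>\<^bsub>K\<^esub>h\<in>carrier G. \<beta> (inv\<^bsub>G\<^esub> x) h \<otimes>\<^bsub>K\<^esub> hat h f')"
    using hat_hom(1) f x eq by (intro K.finsum_cong') (auto simp: hom_def)
  then have "\<iota> (f x) \<otimes>\<^bsub>K\<^esub> [card (carrier G)] \<cdot>\<^bsub>K\<^esub> \<one>\<^bsub>K\<^esub> = \<iota> (f' x) \<otimes>\<^bsub>K\<^esub> [card (carrier G)] \<cdot>\<^bsub>K\<^esub> \<one>\<^bsub>K\<^esub>"
    using f x by (simp add: fourier_inversion)
  then have "\<iota> (f x) = \<iota> (f' x)"
    using f x card_nonzero by (subst (asm) K.m_rcancel) auto
  then show "f x = f' x" using f x \<iota>_inj by (auto dest: inj_onD)
qed

end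

section \<open>The group \<open>C\<^sub>4\<^sup>2 \<times> C\<^sub>2\<close>\<close>

definition C4C4C2 :: "((nat \<Rightarrow> int) \<times> int) monoid"
  where "C4C4C2 = cyclic_power 4 2 \<times>\<times> integer_mod_group 2"

text \<open>Coordinates on the group. Elements of \<open>cyclic_power 4 2\<close> are extensional
  functions on two indices, and \<open>tup\<close> hides this encoding; equality and multiplication
  become coordinatewise.\<close>

definition tup :: "int \<Rightarrow> int \<Rightarrow> int \<Rightarrow> (nat \<Rightarrow> int) \<times> int"
  where "tup a b c = ((\<lambda>i\<in>{..<2}. if i = 0 then a else b), c)"

lemma tup_eq_iff [simp]: "tup a b c = tup a' b' c' \<longleftrightarrow> a = a' \<and> b = b' \<and> c = c'"
proof
  assume eq: "tup a b c = tup a' b' c'"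
  then have "fst (tup a b c) 0 = fst (tup a' b' c') 0" "fst (tup a b c) 1 = fst (tup a' b' c') 1"
    "snd (tup a b c) = snd (tup a' b' c')" by auto
  then show "a = a' \<and> b = b' \<and> c = c'" by (simp add: tup_def)
qed simp

lemma carrier_C4C4C2: "carrier C4C4C2 = (\<lambda>(a, b, c). tup a b c) ` ({0..<4} \<times> {0..<4} \<times> {0..<2})"
proof
  show "carrier C4C4C2 \<subseteq> (\<lambda>(a, b, c). tup a b c) ` ({0..<4} \<times> {0..<4} \<times> {0..<2})"
  proof
    fix g assume "g \<in> carrier C4C4C2"
    then obtain u c where g: "g = (u, c)" "u \<in> {..<2} \<rightarrow>\<^sub>E {0..<4}" "c \<in> {0..<2}"
      by (auto simp: C4C4C2_def cyclic_power_def carrier_integer_mod_group)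
    have "u = (\<lambda>i\<in>{..<2}. if i = 0 then u 0 else u 1)"
    proof
      fix i :: nat
      show "u i = (\<lambda>i\<in>{..<2}. if i = 0 then u 0 else u 1) i"
        using g(2) by (cases "i < 2") (auto simp: PiE_iff extensional_def less_2_cases_iff)
    qed
    then have "g = tup (u 0) (u 1) c" unfolding g(1) tup_def prod.inject by blast
    moreover have "u 0 \<in> {0..<4}" "u 1 \<in> {0..<4}" using g(2) by (auto simp: PiE_iff)
    ultimately show "g \<in> (\<lambda>(a, b, c). tup a b c) ` ({0..<4} \<times> {0..<4} \<times> {0..<2})" using g(3) by force
  qed
qed (auto simp: C4C4C2_def cyclic_power_def carrier_integer_mod_group tup_def)

lemma tup_cases:
  assumes "g \<in> carrier C4C4C2"
  obtains a b c where "g = tup a b c" "a \<in> {0..<4}" "b \<in> {0..<4}" "c \<in> {0..<2}"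
  using assms unfolding carrier_C4C4C2 by auto

lemma tup_in_carrier [simp]:
  "tup a b c \<in> carrier C4C4C2 \<longleftrightarrow> a \<in> {0..<4} \<and> b \<in> {0..<4} \<and> c \<in> {0..<2}"
  unfolding carrier_C4C4C2 by (force simp: image_iff)

lemma card_C4C4C2: "card (carrier C4C4C2) = 32" and finite_C4C4C2: "finite (carrier C4C4C2)"
proof -
  have "inj_on (\<lambda>(a, b, c). tup a b c) B" for B by (auto simp: inj_on_def)
  then show "card (carrier C4C4C2) = 32"
    unfolding carrier_C4C4C2 by (simp add: card_image card_cartesian_product)
qed (simp add: carrier_C4C4C2)

lemma tup_mult: "tup a b c \<otimes>\<^bsub>C4C4C2\<^esub> tup a' b' c' = tup ((a + a') mod 4) ((b + b') mod 4) ((c + c') mod 2)"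
  by (auto simp: tup_def C4C4C2_def cyclic_power_def fun_eq_iff)

lemma tup_one: "\<one>\<^bsub>C4C4C2\<^esub> = tup 0 0 0"
  by (auto simp: tup_def C4C4C2_def cyclic_power_def DirProd_def fun_eq_iff)

lemma comm_group_C4C4C2: "comm_group C4C4C2"
proof (rule group.group_comm_groupI)
  show "group C4C4C2" by (auto simp: C4C4C2_def cyclic_power_def intro!: DirProd_group)
  fix g h assume "g \<in> carrier C4C4C2" "h \<in> carrier C4C4C2"
  then show "g \<otimes>\<^bsub>C4C4C2\<^esub> h = h \<otimes>\<^bsub>C4C4C2\<^esub> g"
    by (elim tup_cases) (simp add: tup_mult add.commute)
qed

section \<open>The pairing, and the inverse pairs of its indices\<close>

text \<open>The exponent of the root of unity in the bicharacter, as a natural number so that it can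
  be used in any monoid. Only its residue modulo 4 matters. The factor 2 makes the coordinate of
  order 2 contribute a sign, and turns a change of that coordinate by 2 into a multiple of
  4.\<close>

definition pairing :: "(nat \<Rightarrow> int) \<times> int \<Rightarrow> (nat \<Rightarrow> int) \<times> int \<Rightarrow> nat"
  where "pairing g h = nat (fst g 0 * fst h 0 + fst g 1 * fst h 1 + 2 * (snd g * snd h))"

lemma pairing_tup: "pairing (tup a b c) (tup a' b' c') = nat (a * a' + b * b' + 2 * (c * c'))"
  by (simp add: pairing_def tup_def)

lemma pairing_commute: "pairing g h = pairing h g"
  by (simp add: pairing_def mult.commute)

lemma pairing_mult:
  assumes "g \<in> carrier C4C4C2" "g' \<in> carrier C4C4C2" "h \<in> carrier C4C4C2"
  shows "[pairing (g \<otimes>\<^bsub>C4C4C2\<^esub> g') h = pairing g h + pairing g' h] (mod 4)"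
proof -
  obtain a b c a' b' c' u v w where t: "g = tup a b c" "g' = tup a' b' c'" "h = tup u v w"
    and r: "a \<ge> 0" "b \<ge> 0" "c \<ge> 0" "a' \<ge> 0" "b' \<ge> 0" "c' \<ge> 0" "u \<ge> 0" "v \<ge> 0" "w \<ge> 0"
    using assms by (elim tup_cases) auto
  let ?L = "(a + a') mod 4 * u + (b + b') mod 4 * v + 2 * ((c + c') mod 2 * w)"
  let ?R = "(a * u + b * v + 2 * (c * w)) + (a' * u + b' * v + 2 * (c' * w))"
  \<comment> \<open>Each reduction modulo 4 drops a multiple of 4; the reduction modulo 2 drops a
    multiple of 2, doubled by the factor in the pairing.\<close>
  have "?R - ?L = 4 * ((a + a') div 4 * u + (b + b') div 4 * v + (c + c') div 2 * w)"
    unfolding minus_mult_div_eq_mod[symmetric] by (simp add: algebra_simps)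
  then have "[?L = ?R] (mod 4)" by (metis cong_iff_dvd_diff cong_sym dvd_triv_left)
  then show ?thesis
    using r by (simp add: t tup_mult pairing_tup cong_int_iff[symmetric])
qed

lemma pairing_nondegenerate:
  assumes "g \<in> carrier C4C4C2" "g \<noteq> \<one>\<^bsub>C4C4C2\<^esub>"
  shows "\<exists>h\<in>carrier C4C4C2. \<not> 4 dvd pairing g h"
proof -
  obtain a b c where g: "g = tup a b c" "a \<in> {0..<4}" "b \<in> {0..<4}" "c \<in> {0..<2}"
    using assms(1) by (rule tup_cases)
  \<comment> \<open>A nonzero coordinate is detected by the generator in its position: the pairing
    is then \<open>a\<close>, \<open>b\<close> or \<open>2 c\<close>, which lies strictly between 0
    and 4.\<close>
  consider "a \<noteq> 0" | "b \<noteq> 0" | "c \<noteq> 0" using assms(2) by (auto simp: g tup_one)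
  then show ?thesis
  proof cases
    case 1
    then have "\<not> 4 dvd pairing g (tup 1 0 0)" using g by (auto simp: pairing_tup dest!: dvd_imp_le)
    then show ?thesis by (intro bexI[of _ "tup 1 0 0"]) auto
  next
    case 2
    then have "\<not> 4 dvd pairing g (tup 0 1 0)" using g by (auto simp: pairing_tup dest!: dvd_imp_le)
    then show ?thesis by (intro bexI[of _ "tup 0 1 0"]) auto
  next
    case 3
    then have "\<not> 4 dvd pairing g (tup 0 0 1)" using g by (auto simp: pairing_tup dest!: dvd_imp_le)
    then show ?thesis by (intro bexI[of _ "tup 0 0 1"]) auto
  qed
qed

text \<open>The solutions of \<open>h^2 = 1\<close>. Their characters take only the values 1 and -1,
  so they have values in the base field.\<close>

definition involutive :: "((nat \<Rightarrow> int) \<times> int) set"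
  where "involutive = (\<lambda>(a, b, c). tup a b c) ` ({0, 2} \<times> {0, 2} \<times> {0, 1})"

text \<open>One element of each pair \<open>{g, g\<inverse>}\<close> with \<open>g \<noteq> g\<inverse>\<close>.\<close>

definition half :: "((nat \<Rightarrow> int) \<times> int) set"
  where "half = (\<lambda>((a, b), c). tup a b c) ` ({(1, 0), (1, 1), (1, 2), (1, 3), (0, 1), (2, 1)} \<times> {0, 1})"

lemma card_involutive: "card involutive = 8"
proof -
  have "inj_on (\<lambda>(a, b, c). tup a b c) B" for B by (auto simp: inj_on_def)
  then show ?thesis
    unfolding involutive_def by (subst card_image) (auto simp: card_cartesian_product)
qed

lemma card_half: "card half = 12"
proof -
  have "inj_on (\<lambda>((a, b), c). tup a b c) B" for B by (auto simp: inj_on_def)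
  then show ?thesis
    unfolding half_def by (subst card_image) (auto simp: card_cartesian_product)
qed

lemma involutive_half:
  "involutive \<subseteq> carrier C4C4C2" "half \<subseteq> carrier C4C4C2" "involutive \<inter> half = {}"
  by (auto simp: involutive_def half_def)

lemma involutive_square:
  assumes "g \<in> involutive"
  shows "g \<otimes>\<^bsub>C4C4C2\<^esub> g = \<one>\<^bsub>C4C4C2\<^esub>"
  using assms by (auto simp: involutive_def tup_mult tup_one)

text \<open>This shows that 8 + 12 indices suffice: the transform at a remaining index is conjugate
  to the one at its inverse, which lies in \<open>half\<close>.\<close>

lemma carrier_half_cover:
  assumes "g \<in> carrier C4C4C2"
  shows "g \<in> involutive \<union> half \<or> inv\<^bsub>C4C4C2\<^esub> g \<in> half"
proof -
  interpret comm_group C4C4C2 by (rule comm_group_C4C4C2)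
  have inv: "inv\<^bsub>C4C4C2\<^esub> (tup a b c) = tup (- a mod 4) (- b mod 4) c"
    if "a \<in> {0..<4}" "b \<in> {0..<4}" "c \<in> {0..<2}" for a b c
    using that by (intro inv_equality) (simp_all add: tup_mult tup_one mod_simps)
  obtain a b c where g: "g = tup a b c" and r: "a \<in> {0..<4}" "b \<in> {0..<4}" "c \<in> {0..<2}"
    using assms by (rule tup_cases)
  have "a \<in> {0, 1, 2, 3}" "b \<in> {0, 1, 2, 3}" "c \<in> {0, 1}" using r by auto
  then show ?thesis
    unfolding g inv[OF r] involutive_def half_def by (elim insertE emptyE) auto
qed

section \<open>Odd characteristic\<close>

lemma (in monoid) pow_cong_4:
  fixes m n :: nat
  assumes "w \<in> carrier G" "w [^] (4::nat) = \<one>" "[m = n] (mod 4)"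
  shows "w [^] m = w [^] n"
proof -
  have "w [^] k = w [^] (k mod 4)" for k :: nat
  proof -
    have "w [^] (4 * (k div 4) + k mod 4) = w [^] (k mod 4)"
      using assms(1,2) by (simp only: nat_pow_mult[symmetric] nat_pow_pow[symmetric] nat_pow_one l_one nat_pow_closed)
    then show ?thesis by simp
  qed
  then show ?thesis using assms(3) unfolding cong_def by metis
qed

lemma (in monoid) pow_eq_one_iff_4_dvd:
  fixes n :: nat
  assumes w: "w \<in> carrier G" "w [^] (4::nat) = \<one>" "w [^] (2::nat) \<noteq> \<one>"
  shows "w [^] n = \<one> \<longleftrightarrow> 4 dvd n"
proof
  assume n: "w [^] n = \<one>"
  show "4 dvd n"
  proof (rule ccontr)
    assume "\<not> 4 dvd n"
    then have "n mod 4 \<noteq> 0" "n mod 4 < 4" using mod_0_imp_dvd[of n 4] by auto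
    then have "n mod 4 = 1 \<or> n mod 4 = 2 \<or> n mod 4 = 3" by linarith
    \<comment> \<open>An odd residue is doubled to reach 2, and the residue 2 is used as it is. In
      either case \<open>w^2 = 1\<close> would follow.\<close>
    then have "[n * 2 = 2] (mod 4) \<or> [n = 2] (mod 4)"
      using mod_mult_left_eq[of n 4 2] by (auto simp: cong_def)
    then have "w [^] (n * 2) = w [^] (2::nat) \<or> w [^] n = w [^] (2::nat)"
      using pow_cong_4[OF w(1,2), of "n * 2" 2] pow_cong_4[OF w(1,2), of n 2] by blast
    moreover have "w [^] (n * 2) = \<one>" using n w nat_pow_pow[OF w(1), of n 2] by simp
    ultimately show False using n w by metis
  qed
next
  assume "4 dvd n"
  then have "[n = 0] (mod 4)" by (simp add: cong_0_iff)
  then show "w [^] n = \<one>" using pow_cong_4[OF w(1,2), of n 0] by simp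
qed

lemma finite_field_primitive_fourth_root:
  assumes "field F" "finite (carrier F)" "4 dvd card (carrier F) - 1"
  shows "\<exists>w\<in>carrier F. w [^]\<^bsub>F\<^esub> (4::nat) = \<one>\<^bsub>F\<^esub> \<and> w [^]\<^bsub>F\<^esub> (2::nat) \<noteq> \<one>\<^bsub>F\<^esub>"
proof -
  interpret field F by fact
  let ?N = "card (carrier F) - 1"
  interpret Z: group "integer_mod_group ?N" by simp
  interpret U: group "units_of F" by (rule units_group)
  have "{\<zero>\<^bsub>F\<^esub>, \<one>\<^bsub>F\<^esub>} \<subseteq> carrier F" by simp
  then have "card {\<zero>\<^bsub>F\<^esub>, \<one>\<^bsub>F\<^esub>} \<le> card (carrier F)" using assms(2) by (rule card_mono[rotated])
  then have N: "?N > 0" by simp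
  obtain k where k: "?N = 4 * k" using assms(3) by blast
  have "integer_mod_group ?N \<cong> units_of F"
    using units_of_finite_field[OF assms(1,2)] by (rule U.iso_sym)
  then obtain \<phi> where \<phi>: "\<phi> \<in> hom (integer_mod_group ?N) (units_of F)"
      "inj_on \<phi> (carrier (integer_mod_group ?N))"
    by (auto simp: is_iso_def iso_def bij_betw_def)
  interpret \<phi>: group_hom "integer_mod_group ?N" "units_of F" \<phi> by unfold_locales (rule \<phi>)
  have kc: "int k \<in> carrier (integer_mod_group ?N)" "int (2 * k) \<in> carrier (integer_mod_group ?N)"
    using k N by (auto simp: carrier_integer_mod_group)
  \<comment> \<open>The unit group is cyclic of order \<open>4 k\<close>, so the residue
    \<open>k\<close> corresponds to an element of order 4.\<close>
  let ?w = "\<phi> (int k)"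
  have u: "?w \<in> Units F" using \<phi>.hom_closed[OF kc(1)] by (simp add: units_of_carrier)
  have pw: "?w [^]\<^bsub>F\<^esub> n = \<phi> ((int n * int k) mod int ?N)" for n :: nat
    using \<phi>.hom_nat_pow[OF kc(1), of n] units_of_pow[OF u, of n] by simp
  have "?w [^]\<^bsub>F\<^esub> (4::nat) = \<one>\<^bsub>F\<^esub>" using pw[of 4] k \<phi>.hom_one by (simp add: units_of_one)
  moreover have "?w [^]\<^bsub>F\<^esub> (2::nat) \<noteq> \<one>\<^bsub>F\<^esub>"
  proof
    assume "?w [^]\<^bsub>F\<^esub> (2::nat) = \<one>\<^bsub>F\<^esub>"
    then have "\<phi> (int (2 * k)) = \<phi> 0" using pw[of 2] k N \<phi>.hom_one by (simp add: units_of_one)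
    then have "int (2 * k) = 0" using \<phi>(2) kc(2) by (auto dest: inj_onD)
    then show False using k N by simp
  qed
  ultimately show ?thesis using u by blast
qed

text \<open>A square root \<open>a\<close> of -1 satisfies \<open>a^4 = 1\<close>, and also
  \<open>a^(q-1) = 1\<close> with \<open>q - 1\<close> congruent to 2 modulo 4. Hence
  \<open>a^2 = 1\<close>, which gives -1 = 1, against 2 being nonzero.\<close>

lemma finite_field_no_sqrt_minus_one:
  assumes "field F" "finite (carrier F)" "[card (carrier F) = 3] (mod 4)"
    and "\<one>\<^bsub>F\<^esub> \<oplus>\<^bsub>F\<^esub> \<one>\<^bsub>F\<^esub> \<noteq> \<zero>\<^bsub>F\<^esub>" and a: "a \<in> carrier F"
  shows "a \<otimes>\<^bsub>F\<^esub> a \<noteq> \<ominus>\<^bsub>F\<^esub> \<one>\<^bsub>F\<^esub>"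
proof
  interpret field F by fact
  assume sq: "a \<otimes>\<^bsub>F\<^esub> a = \<ominus>\<^bsub>F\<^esub> \<one>\<^bsub>F\<^esub>"
  have a2: "a [^]\<^bsub>F\<^esub> (2::nat) = \<ominus>\<^bsub>F\<^esub> \<one>\<^bsub>F\<^esub>" using sq a by (simp add: numeral_2_eq_2)
  have "a [^]\<^bsub>F\<^esub> (4::nat) = (a [^]\<^bsub>F\<^esub> (2::nat)) [^]\<^bsub>F\<^esub> (2::nat)"
    using a by (simp add: nat_pow_pow)
  also have "\<dots> = \<one>\<^bsub>F\<^esub>" unfolding a2 by (simp add: numeral_2_eq_2 l_minus r_minus)
  finally have a4: "a [^]\<^bsub>F\<^esub> (4::nat) = \<one>\<^bsub>F\<^esub>" .
  have "a \<noteq> \<zero>\<^bsub>F\<^esub>"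
    using sq by (metis l_null minus_minus minus_zero one_closed one_not_zero zero_closed)
  then have u: "a \<in> Units F" using a by (simp add: field_Units)
  interpret U: group "units_of F" by (rule units_group)
  have "order (units_of F) = card (carrier F) - 1"
    using assms(2) by (simp add: order_def units_of_carrier field_Units card_Diff_singleton)
  then have 1: "a [^]\<^bsub>F\<^esub> (card (carrier F) - 1) = \<one>\<^bsub>F\<^esub>"
    using U.pow_order_eq_1[of a] u by (simp add: units_of_carrier units_of_pow units_of_one)
  obtain k where "card (carrier F) = 4 * k + 3"
    using assms(3) mult_div_mod_eq[of 4 "card (carrier F)"] that[of "card (carrier F) div 4"]
    by (simp add: cong_def)
  then have "card (carrier F) - 1 = 4 * k + 2" by simp
  then have "[card (carrier F) - 1 = 2] (mod 4)" by (simp only: cong_def mod_mult_self4)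
  then have "a [^]\<^bsub>F\<^esub> (2::nat) = \<one>\<^bsub>F\<^esub>"
    using pow_cong_4[OF a a4, of "card (carrier F) - 1" 2] 1 by simp
  then have "\<one>\<^bsub>F\<^esub> = \<ominus>\<^bsub>F\<^esub> \<one>\<^bsub>F\<^esub>" using a2 by simp
  then show False using assms(4) r_neg[of "\<one>\<^bsub>F\<^esub>"] by simp
qed

lemma bicharacter_C4C4C2:
  assumes R: "cring R" and K: "domain K" and \<iota>: "\<iota> \<in> ring_hom R K" "inj_on \<iota> (carrier R)"
    and w: "w \<in> carrier K" "w [^]\<^bsub>K\<^esub> (4::nat) = \<one>\<^bsub>K\<^esub>" "w [^]\<^bsub>K\<^esub> (2::nat) \<noteq> \<one>\<^bsub>K\<^esub>"
    and 32: "[(32::nat)] \<cdot>\<^bsub>R\<^esub> \<one>\<^bsub>R\<^esub> \<noteq> \<zero>\<^bsub>R\<^esub>"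
  shows "bicharacter R C4C4C2 K \<iota> (\<lambda>g h. w [^]\<^bsub>K\<^esub> pairing g h)"
proof -
  interpret R: cring R by fact
  interpret K: domain K by fact
  interpret G: comm_group C4C4C2 by (rule comm_group_C4C4C2)
  interpret \<iota>: ring_hom_cring R K \<iota> by unfold_locales (rule \<iota>)
  \<comment> \<open>Since \<open>\<iota>\<close> is injective and preserves multiples of 1, the
    group order 32 stays nonzero in \<open>K\<close>.\<close>
  have \<iota>pow: "\<iota> ([n] \<cdot>\<^bsub>R\<^esub> \<one>\<^bsub>R\<^esub>) = [n] \<cdot>\<^bsub>K\<^esub> \<one>\<^bsub>K\<^esub>" for n :: nat
    by (induction n) (simp_all add: R.add.nat_pow_Suc K.add.nat_pow_Suc)
  show ?thesis
  proof unfold_locales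
    fix g g' h assume gh: "g \<in> carrier C4C4C2" "g' \<in> carrier C4C4C2" "h \<in> carrier C4C4C2"
    show *: "w [^]\<^bsub>K\<^esub> pairing (g \<otimes>\<^bsub>C4C4C2\<^esub> g') h = w [^]\<^bsub>K\<^esub> pairing g h \<otimes>\<^bsub>K\<^esub> w [^]\<^bsub>K\<^esub> pairing g' h"
      using K.pow_cong_4[OF w(1,2) pairing_mult[OF gh]] w(1) by (simp add: K.nat_pow_mult)
    show "w [^]\<^bsub>K\<^esub> pairing h (g \<otimes>\<^bsub>C4C4C2\<^esub> g') = w [^]\<^bsub>K\<^esub> pairing h g \<otimes>\<^bsub>K\<^esub> w [^]\<^bsub>K\<^esub> pairing h g'"
      using * by (simp add: pairing_commute[of h])
  next
    fix h show "w [^]\<^bsub>K\<^esub> pairing \<one>\<^bsub>C4C4C2\<^esub> h = \<one>\<^bsub>K\<^esub>" by (simp add: tup_one pairing_def tup_def)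
  next
    fix g assume "g \<in> carrier C4C4C2" "g \<noteq> \<one>\<^bsub>C4C4C2\<^esub>"
    then show "\<exists>h\<in>carrier C4C4C2. w [^]\<^bsub>K\<^esub> pairing g h \<noteq> \<one>\<^bsub>K\<^esub>"
      using pairing_nondegenerate K.pow_eq_one_iff_4_dvd[OF w] by blast
  next
    show "[card (carrier C4C4C2)] \<cdot>\<^bsub>K\<^esub> \<one>\<^bsub>K\<^esub> \<noteq> \<zero>\<^bsub>K\<^esub>"
      unfolding card_C4C4C2 using 32 \<iota>pow[of 32] \<iota>(2)
      by (metis R.add.nat_pow_closed R.one_closed R.zero_closed \<iota>.hom_zero inj_onD)
  qed (use \<iota> w finite_C4C4C2 in auto)
qed

lemma units_group_algebra_split:
  assumes F: "field F" "finite (carrier F)" and 32: "[(32::nat)] \<cdot>\<^bsub>F\<^esub> \<one>\<^bsub>F\<^esub> \<noteq> \<zero>\<^bsub>F\<^esub>"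
    and w: "w \<in> carrier F" "w [^]\<^bsub>F\<^esub> (4::nat) = \<one>\<^bsub>F\<^esub>" "w [^]\<^bsub>F\<^esub> (2::nat) \<noteq> \<one>\<^bsub>F\<^esub>"
  shows "units_of (group_algebra F C4C4C2) \<cong> cyclic_power (card (carrier F) - 1) 32"
proof -
  interpret F: field F by fact
  interpret bicharacter F C4C4C2 F "\<lambda>x. x" "\<lambda>g h. w [^]\<^bsub>F\<^esub> pairing g h"
    by (rule bicharacter_C4C4C2[OF F.is_cring F.domain_axioms _ _ w 32]) (auto simp: ring_hom_def)
  \<comment> \<open>Infinite sets have cardinality 0, so a positive power of \<open>q\<close> as
    cardinality already gives finiteness.\<close>
  have "card (carrier A) > 0" using F(2) F.one_closed by (auto simp: card_A card_gt_0_iff)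
  then have "finite (carrier A)" by (simp add: card_gt_0_iff)
  then have "units_of A \<cong> product_group (carrier C4C4C2) (\<lambda>_. units_of F)"
    by (rule units_iso_product_group[OF comm_monoid_A, where \<chi> = "hat"])
      (auto simp: finite_C4C4C2 hat_hom card_A F.comm_monoid_axioms intro: hat_jointly_inj)
  also have "\<dots> \<cong> cyclic_power (card (carrier F) - 1) (card (carrier C4C4C2))"
    using units_of_finite_field[OF F] F.units_group
    by (intro product_group_iso_cyclic_power) (auto simp: finite_C4C4C2)
  finally show ?thesis by (simp add: card_C4C4C2)
qed

text \<open>Conjugation \<open>\<sigma>\<close> of \<open>F[i]\<close> turns the transform at
  \<open>h\<close> into the transform at the inverse of \<open>h\<close>. So the transforms at
  \<open>involutive\<close> are fixed by \<open>\<sigma>\<close> and lie in \<open>F\<close>, while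
  those at \<open>half\<close> determine their conjugates.\<close>

lemma units_group_algebra_nonsplit:
  fixes F :: "('a, 'b) ring_scheme"
  assumes F: "field F" "finite (carrier F)" and 32: "[(32::nat)] \<cdot>\<^bsub>F\<^esub> \<one>\<^bsub>F\<^esub> \<noteq> \<zero>\<^bsub>F\<^esub>"
    and two: "\<one>\<^bsub>F\<^esub> \<oplus>\<^bsub>F\<^esub> \<one>\<^bsub>F\<^esub> \<noteq> \<zero>\<^bsub>F\<^esub>"
    and nosqrt: "\<And>a. a \<in> carrier F \<Longrightarrow> a \<otimes>\<^bsub>F\<^esub> a \<noteq> \<ominus>\<^bsub>F\<^esub> \<one>\<^bsub>F\<^esub>"
  shows "units_of (group_algebra F C4C4C2)
    \<cong> cyclic_power (card (carrier F) - 1) 8 \<times>\<times> cyclic_power (card (carrier F) ^ 2 - 1) 12"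
proof -
  interpret F: field F by fact
  \<comment> \<open>\<open>?Z\<close> is the copy of \<open>F\<close> inside \<open>?L\<close>,
    needed because the factors of the product must share one type.\<close>
  let ?L = "gaussian F (carrier F)" and ?Z = "gaussian F {\<zero>\<^bsub>F\<^esub>}"
  have L: "field ?L" "field ?Z"
    using F.oneideal F.zeroideal by (auto intro!: field_gaussian F(1) nosqrt)
  interpret L: field ?L by (rule L)
  interpret Z: field ?Z by (rule L)
  let ?\<iota> = "\<lambda>a. (a, \<zero>\<^bsub>F\<^esub>)" and ?w = "(\<zero>\<^bsub>F\<^esub>, \<one>\<^bsub>F\<^esub>)"
  have \<iota>: "?\<iota> \<in> ring_hom F ?L"
    by (rule ring_hom_memI) (auto simp: F.minus_eq)
  have one_ne: "\<ominus>\<^bsub>F\<^esub> \<one>\<^bsub>F\<^esub> \<noteq> \<one>\<^bsub>F\<^esub>"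
    using two F.r_neg[OF F.one_closed] by auto
  have w2: "?w [^]\<^bsub>?L\<^esub> (2::nat) = (\<ominus>\<^bsub>F\<^esub> \<one>\<^bsub>F\<^esub>, \<zero>\<^bsub>F\<^esub>)"
    by (simp add: numeral_2_eq_2 F.minus_eq)
  have w: "?w \<in> carrier ?L" unfolding gaussian_simps by (intro SigmaI F.zero_closed F.one_closed)
  have "?w [^]\<^bsub>?L\<^esub> (4::nat) = (?w [^]\<^bsub>?L\<^esub> (2::nat)) [^]\<^bsub>?L\<^esub> (2::nat)"
    using L.nat_pow_pow[OF w, of 2 2] by simp
  also have "\<dots> = \<one>\<^bsub>?L\<^esub>"
    unfolding w2 by (simp add: numeral_2_eq_2 F.minus_eq F.l_minus F.r_minus)
  finally have w4: "?w [^]\<^bsub>?L\<^esub> (4::nat) = \<one>\<^bsub>?L\<^esub>" .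
  interpret bicharacter F C4C4C2 ?L ?\<iota> "\<lambda>g h. ?w [^]\<^bsub>?L\<^esub> pairing g h"
    by (rule bicharacter_C4C4C2[OF F.is_cring L.domain_axioms \<iota> _ w w4 _ 32])
      (use w2 one_ne in \<open>auto simp: inj_on_def\<close>)
  let ?\<beta> = "\<lambda>g h. ?w [^]\<^bsub>?L\<^esub> pairing g h"
  define \<sigma> where "\<sigma> = (\<lambda>(a :: 'a, b :: 'a). (a, \<ominus>\<^bsub>F\<^esub> b))"
  have \<sigma>: "\<sigma> \<in> ring_hom ?L ?L"
    by (rule ring_hom_memI)
      (auto simp: \<sigma>_def F.l_minus F.r_minus F.minus_eq F.minus_add)
  interpret \<sigma>: ring_hom_cring ?L ?L \<sigma> by unfold_locales (rule \<sigma>)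
  have \<sigma>pow: "\<sigma> (?w [^]\<^bsub>?L\<^esub> n) = \<sigma> ?w [^]\<^bsub>?L\<^esub> n" for n :: nat
  proof (induction n)
    case 0
    show ?case by (simp only: L.nat_pow_0 \<sigma>.hom_one)
  next
    case (Suc n)
    show ?case by (simp only: L.nat_pow_Suc \<sigma>.hom_mult[OF L.nat_pow_closed[OF w] w] Suc)
  qed
  have \<sigma>\<beta>: "\<sigma> (?\<beta> g h) = ?\<beta> g (inv\<^bsub>C4C4C2\<^esub> h)" if gh: "g \<in> carrier C4C4C2" "h \<in> carrier C4C4C2" for g h
  proof -
    \<comment> \<open>Conjugation sends \<open>?w\<close> to its inverse, so
      \<open>\<sigma> (?\<beta> g h)\<close> and \<open>?\<beta> g\<close> at the inverse of
      \<open>h\<close> are both inverse to \<open>?\<beta> g h\<close>; the equality follows by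
      cancellation.\<close>
    have one: "?\<beta> g (inv\<^bsub>C4C4C2\<^esub> h) \<otimes>\<^bsub>?L\<^esub> ?\<beta> g h = \<one>\<^bsub>?L\<^esub>"
      using \<beta>_mult_left[of "inv\<^bsub>C4C4C2\<^esub> h" h g] \<beta>_one_left[of g] gh
      by (simp add: pairing_commute[of g])
    have "\<sigma> (?\<beta> g h) \<otimes>\<^bsub>?L\<^esub> ?\<beta> g h = ((\<sigma> ?w) \<otimes>\<^bsub>?L\<^esub> ?w) [^]\<^bsub>?L\<^esub> pairing g h"
      using \<sigma>pow w by (simp only: \<sigma>.hom_closed L.nat_pow_distrib)
    also have "\<sigma> ?w \<otimes>\<^bsub>?L\<^esub> ?w = \<one>\<^bsub>?L\<^esub>"
      by (simp add: \<sigma>_def F.l_minus F.minus_eq)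
    also have "\<one>\<^bsub>?L\<^esub> [^]\<^bsub>?L\<^esub> pairing g h = \<one>\<^bsub>?L\<^esub>" by (rule L.nat_pow_one)
    also have "\<one>\<^bsub>?L\<^esub> = ?\<beta> g (inv\<^bsub>C4C4C2\<^esub> h) \<otimes>\<^bsub>?L\<^esub> ?\<beta> g h" by (rule one[symmetric])
    finally have eq: "\<sigma> (?\<beta> g h) \<otimes>\<^bsub>?L\<^esub> ?\<beta> g h = ?\<beta> g (inv\<^bsub>C4C4C2\<^esub> h) \<otimes>\<^bsub>?L\<^esub> ?\<beta> g h" .
    moreover have "?\<beta> g h \<noteq> \<zero>\<^bsub>?L\<^esub>"
    proof
      assume "?\<beta> g h = \<zero>\<^bsub>?L\<^esub>"
      then have "\<zero>\<^bsub>?L\<^esub> = ?\<beta> g (inv\<^bsub>C4C4C2\<^esub> h) \<otimes>\<^bsub>?L\<^esub> ?\<beta> g h"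
        using gh \<beta>_closed[of g "inv\<^bsub>C4C4C2\<^esub> h"] L.r_null by simp
      also have "\<dots> = \<one>\<^bsub>?L\<^esub>" by (rule one)
      finally show False by simp
    qed
    ultimately show ?thesis
      using L.m_rcancel \<sigma>.hom_closed \<beta>_closed gh by (metis G.inv_closed)
  qed
  have \<sigma>hat: "\<sigma> (hat h f) = hat (inv\<^bsub>C4C4C2\<^esub> h) f" if f: "f \<in> carrier A" and h: "h \<in> carrier C4C4C2" for f h
  proof -
    have "\<sigma> (hat h f) = (\<Oplus>\<^bsub>?L\<^esub>g\<in>carrier C4C4C2. (\<sigma> \<circ> (\<lambda>g. ?\<iota> (f g) \<otimes>\<^bsub>?L\<^esub> ?\<beta> g h)) g)"
      unfolding transform_def
      by (intro \<sigma>.hom_finsum Pi_I L.m_closed \<iota>_closed \<beta>_closed closed_A f h) assumption+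
    also have "\<dots> = hat (inv\<^bsub>C4C4C2\<^esub> h) f"
      unfolding transform_def
    proof (rule L.finsum_cong')
      fix g assume g: "g \<in> carrier C4C4C2"
      have "\<sigma> (?\<iota> (f g) \<otimes>\<^bsub>?L\<^esub> ?\<beta> g h) = \<sigma> (?\<iota> (f g)) \<otimes>\<^bsub>?L\<^esub> \<sigma> (?\<beta> g h)"
        by (intro \<sigma>.hom_mult \<iota>_closed \<beta>_closed closed_A f g h)
      then show "(\<sigma> \<circ> (\<lambda>g. ?\<iota> (f g) \<otimes>\<^bsub>?L\<^esub> ?\<beta> g h)) g = ?\<iota> (f g) \<otimes>\<^bsub>?L\<^esub> ?\<beta> g (inv\<^bsub>C4C4C2\<^esub> h)"
        using \<sigma>\<beta>[OF g h] by (simp add: \<sigma>_def)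
    qed (rule refl, intro Pi_I L.m_closed \<iota>_closed \<beta>_closed closed_A G.inv_closed f h, assumption+)
    finally show ?thesis .
  qed
  let ?J = "involutive \<union> half"
  let ?K = "\<lambda>h. if h \<in> involutive then ?Z else ?L"
  have fin: "finite involutive" "finite half"
    using involutive_half by (auto intro: finite_subset[OF _ finite_C4C4C2])
  have hatc: "hat h f \<in> carrier ?L" if "f \<in> carrier A" "h \<in> carrier C4C4C2" for f h
    using hat_hom(1)[OF that(2)] that(1) by (auto simp: hom_def)
  have real: "hat h f \<in> carrier ?Z" if f: "f \<in> carrier A" and h: "h \<in> involutive" for f h
  proof -
    have hG: "h \<in> carrier C4C4C2" using h involutive_half by auto
    have "inv\<^bsub>C4C4C2\<^esub> h = h" using involutive_square[OF h] hG by (intro G.inv_equality)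
    then have "\<sigma> (hat h f) = hat h f" using \<sigma>hat[OF f hG] by simp
    moreover obtain a b where ab: "hat h f = (a, b)" "a \<in> carrier F" "b \<in> carrier F"
      using hatc[OF f hG] by auto
    \<comment> \<open>A fixed point of conjugation has imaginary part \<open>b = -b\<close>, and 2
      is invertible.\<close>
    ultimately have "\<ominus>\<^bsub>F\<^esub> b = b" by (simp add: \<sigma>_def)
    then have "b \<oplus>\<^bsub>F\<^esub> b = \<zero>\<^bsub>F\<^esub>" using F.r_neg[OF ab(3)] by simp
    then have "(\<one>\<^bsub>F\<^esub> \<oplus>\<^bsub>F\<^esub> \<one>\<^bsub>F\<^esub>) \<otimes>\<^bsub>F\<^esub> b = \<zero>\<^bsub>F\<^esub>" using ab by (simp add: F.l_distr)
    then have "b = \<zero>\<^bsub>F\<^esub>" using two ab F.integral_iff by simp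
    then show ?thesis using ab by simp
  qed
  \<comment> \<open>\<open>?Z\<close> and \<open>?L\<close> have the same operations and differ only
    in their carriers, so only the range of \<open>hat h\<close> has to be checked.\<close>
  have hom0: "hat h \<in> hom A ?Z" if "h \<in> involutive" for h
    using hat_hom(1)[of h] real[OF _ that] that involutive_half by (auto simp: hom_def gaussian_def)
  have "card (carrier A) > 0" using F(2) F.one_closed by (auto simp: card_A card_gt_0_iff)
  then have finA: "finite (carrier A)" by (simp add: card_gt_0_iff)
  have "units_of A \<cong> product_group ?J (\<lambda>h. units_of (?K h))"
  proof (rule units_iso_product_group[OF comm_monoid_A finA, where \<chi> = "hat"])
    show "finite ?J" using fin by simp
    show "comm_monoid (?K h)" for h using L.comm_monoid_axioms Z.comm_monoid_axioms by simp
    show "hat h \<in> hom A (?K h)" if "h \<in> ?J" for h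
      using that hom0 hat_hom(1)[of h] involutive_half by auto
    show "hat h \<one>\<^bsub>A\<^esub> = \<one>\<^bsub>?K h\<^esub>" if "h \<in> ?J" for h
      using that hat_hom(2)[of h] involutive_half by auto
    show "f = f'" if f: "f \<in> carrier A" "f' \<in> carrier A" and eq: "\<And>h. h \<in> ?J \<Longrightarrow> hat h f = hat h f'" for f f'
    proof (rule hat_jointly_inj[OF f])
      fix h assume h: "h \<in> carrier C4C4C2"
      show "hat h f = hat h f'"
      proof (cases "h \<in> ?J")
        case False
        \<comment> \<open>Agreement at the inverse index is carried back to \<open>h\<close> by
          applying \<open>\<sigma>\<close>.\<close>
        then have "inv\<^bsub>C4C4C2\<^esub> h \<in> half" using carrier_half_cover[OF h] by auto
        then have "hat (inv\<^bsub>C4C4C2\<^esub> h) f = hat (inv\<^bsub>C4C4C2\<^esub> h) f'" using eq by auto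
        then have "\<sigma> (hat (inv\<^bsub>C4C4C2\<^esub> h) f) = \<sigma> (hat (inv\<^bsub>C4C4C2\<^esub> h) f')" by simp
        then show ?thesis using \<sigma>hat[OF f(1), of "inv\<^bsub>C4C4C2\<^esub> h"] \<sigma>hat[OF f(2), of "inv\<^bsub>C4C4C2\<^esub> h"] h by simp
      qed (rule eq)
    qed
    \<comment> \<open>The cardinalities match: \<open>q^8\<close> from the involutive indices times
      \<open>(q^2)^12\<close> from the others is \<open>q^32\<close>.\<close>
    let ?q = "card (carrier F)"
    have "(\<Prod>h\<in>?J. card (carrier (?K h)))
        = (\<Prod>h\<in>involutive. card (carrier (?K h))) * (\<Prod>h\<in>half. card (carrier (?K h)))"
      using fin involutive_half by (intro prod.union_disjoint) auto
    also have "(\<Prod>h\<in>involutive. card (carrier (?K h))) = (\<Prod>h\<in>involutive. ?q)"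
      by (intro prod.cong) (auto simp: card_cartesian_product)
    also have "(\<Prod>h\<in>half. card (carrier (?K h))) = (\<Prod>h\<in>half. ?q ^ 2)"
      using involutive_half by (intro prod.cong) (auto simp: card_cartesian_product power2_eq_square)
    finally show "card (carrier A) = (\<Prod>h\<in>?J. card (carrier (?K h)))"
      by (simp add: card_involutive card_half card_A card_C4C4C2 power_mult[symmetric] power_add[symmetric])
  qed
  also have "\<dots> \<cong> product_group involutive (\<lambda>h. units_of (?K h)) \<times>\<times> product_group half (\<lambda>h. units_of (?K h))"
    using involutive_half by (intro product_group_Un_disjoint)
  also have "\<dots> \<cong> cyclic_power (card (carrier F) - 1) (card involutive) \<times>\<times>
      cyclic_power (card (carrier F) ^ 2 - 1) (card half)"
  proof (rule DirProd_cong; rule product_group_iso_cyclic_power)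
    fix h
    assume "h \<in> involutive"
    then show "units_of (?K h) \<cong> integer_mod_group (card (carrier F) - 1)"
      using units_of_finite_field[OF L(2)] F(2) by (simp add: card_cartesian_product)
  next
    fix h
    assume "h \<in> half"
    then show "units_of (?K h) \<cong> integer_mod_group (card (carrier F) ^ 2 - 1)"
      using units_of_finite_field[OF L(1)] F(2) involutive_half
      by (auto simp: card_cartesian_product power2_eq_square)
  qed (use fin L.units_group Z.units_group in auto)
  finally show ?thesis by (simp add: card_involutive card_half)
qed

section \<open>Characteristic 2\<close>

text \<open>The points moved by \<open>\<sigma>\<close> fall into pairs with equal terms, which
  cancel since doubling is zero. The induction removes one such pair at a time.\<close>

lemma (in abelian_monoid) finsum_involution:
  assumes two: "\<And>a. a \<in> carrier G \<Longrightarrow> a \<oplus> a = \<zero>"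
    and "finite A" "\<sigma> \<in> A \<rightarrow> A" "\<And>x. x \<in> A \<Longrightarrow> \<sigma> (\<sigma> x) = x"
    and "t \<in> A \<rightarrow> carrier G" "\<And>x. x \<in> A \<Longrightarrow> t (\<sigma> x) = t x"
  shows "(\<Oplus>x\<in>A. t x) = (\<Oplus>x\<in>{x \<in> A. \<sigma> x = x}. t x)"
  using assms(2-)
proof (induction A rule: finite_psubset_induct)
  case (psubset A)
  show ?case
  proof (cases "\<forall>x\<in>A. \<sigma> x = x")
    case True
    then have "{x \<in> A. \<sigma> x = x} = A" by auto
    then show ?thesis by simp
  next
    case False
    then obtain x where x: "x \<in> A" "\<sigma> x \<noteq> x" by blast
    let ?B = "A - {x, \<sigma> x}"
    have \<sigma>x: "\<sigma> x \<in> A" using x psubset.prems(1) by auto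
    have tc: "t x \<in> carrier G" using x psubset.prems(3) by auto
    have Bc: "t \<in> ?B \<rightarrow> carrier G" using psubset.prems(3) by auto
    have A: "A = insert x (insert (\<sigma> x) ?B)" using x \<sigma>x by auto
    have "(\<Oplus>x\<in>A. t x) = (\<Oplus>y\<in>insert x (insert (\<sigma> x) ?B). t y)" using A by simp
    also have "\<dots> = t x \<oplus> (t (\<sigma> x) \<oplus> (\<Oplus>y\<in>?B. t y))"
      using psubset.hyps(1) x Bc tc psubset.prems(4)[OF x(1)] by (simp add: Pi_iff)
    also have "\<dots> = (\<Oplus>y\<in>?B. t y)"
      using tc Bc psubset.prems(4)[OF x(1)] by (simp add: a_assoc[symmetric] two finsum_closed)
    also have "\<dots> = (\<Oplus>y\<in>{y \<in> ?B. \<sigma> y = y}. t y)"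
    proof (rule psubset.IH)
      show "?B \<subset> A" using x by auto
      show "\<sigma> \<in> ?B \<rightarrow> ?B"
      proof
        fix y assume y: "y \<in> ?B"
        have "\<sigma> y \<noteq> x" "\<sigma> y \<noteq> \<sigma> x"
          using y x psubset.prems(2)[of y] psubset.prems(2)[of x] by auto
        then show "\<sigma> y \<in> ?B" using y psubset.prems(1) by auto
      qed
    qed (use psubset.prems in auto)
    also have "{y \<in> ?B. \<sigma> y = y} = {x \<in> A. \<sigma> x = x}"
      using x psubset.prems(2)[OF x(1)] by auto
    finally show ?thesis .
  qed
qed

section \<open>Augmentation, squares and fourth powers\<close>

context finite_group_ring
begin

definition aug :: "('c \<Rightarrow> 'a) \<Rightarrow> 'a"
  where "aug = transform R (\<lambda>a. a) (\<lambda>_. \<one>)"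

lemma aug_eq: "f \<in> carrier A \<Longrightarrow> aug f = (\<Oplus>g\<in>carrier G. f g)"
  unfolding aug_def transform_def by (rule finsum_cong') auto

lemma aug_closed [simp]: "f \<in> carrier A \<Longrightarrow> aug f \<in> carrier R"
  using closed_A by (simp add: aug_eq finsum_closed)

lemma aug_mult: "f \<in> carrier A \<Longrightarrow> h \<in> carrier A \<Longrightarrow> aug (f \<otimes>\<^bsub>A\<^esub> h) = aug f \<otimes> aug h"
  and aug_one: "aug \<one>\<^bsub>A\<^esub> = \<one>"
proof -
  have "(\<lambda>a. a) \<in> ring_hom R R" "(\<lambda>_. \<one>) \<in> hom G R"
    by (simp_all add: ring_hom_def hom_def)
  note hom = transform_hom[OF R.is_cring this refl, folded aug_def]
  show "f \<in> carrier A \<Longrightarrow> h \<in> carrier A \<Longrightarrow> aug (f \<otimes>\<^bsub>A\<^esub> h) = aug f \<otimes> aug h"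
    by (rule hom_mult[OF hom(1)])
  show "aug \<one>\<^bsub>A\<^esub> = \<one>" by (rule hom(2))
qed

lemma aug_support:
  assumes "f \<in> carrier A" "D \<subseteq> carrier G" "\<And>x. x \<in> carrier G - D \<Longrightarrow> f x = \<zero>"
  shows "aug f = (\<Oplus>g\<in>D. f g)"
  unfolding aug_eq[OF assms(1)]
  using assms by (intro add.finprod_mono_neutral_cong_right finite_G) auto

lemma aug_single:
  assumes "a \<in> carrier R"
  shows "aug (single \<one>\<^bsub>G\<^esub> a) = a"
proof -
  have "aug (single \<one>\<^bsub>G\<^esub> a) = (\<Oplus>g\<in>{\<one>\<^bsub>G\<^esub>}. single \<one>\<^bsub>G\<^esub> a g)"
    by (rule aug_support[OF single_closed[OF assms]]) (auto simp: single_def)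
  also have "\<dots> = a" using assms by (simp add: single_def)
  finally show ?thesis .
qed

lemma single_mult_single:
  assumes "a \<in> carrier R" "b \<in> carrier R"
  shows "single \<one>\<^bsub>G\<^esub> a \<otimes>\<^bsub>A\<^esub> single \<one>\<^bsub>G\<^esub> b = single \<one>\<^bsub>G\<^esub> (a \<otimes> b)"
proof (rule ext_A)
  show "single \<one>\<^bsub>G\<^esub> a \<otimes>\<^bsub>A\<^esub> single \<one>\<^bsub>G\<^esub> b \<in> carrier A" "single \<one>\<^bsub>G\<^esub> (a \<otimes> b) \<in> carrier A"
    using assms by (simp_all add: mult_A_closed)
  fix x assume x: "x \<in> carrier G"
  have "(single \<one>\<^bsub>G\<^esub> a \<otimes>\<^bsub>A\<^esub> single \<one>\<^bsub>G\<^esub> b) x = a \<otimes> single \<one>\<^bsub>G\<^esub> b x"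
    using assms x by (simp add: single_mult)
  also have "\<dots> = single \<one>\<^bsub>G\<^esub> (a \<otimes> b) x"
    using assms x by (simp add: single_def)
  finally show "(single \<one>\<^bsub>G\<^esub> a \<otimes>\<^bsub>A\<^esub> single \<one>\<^bsub>G\<^esub> b) x = single \<one>\<^bsub>G\<^esub> (a \<otimes> b) x" .
qed

text \<open>The coefficients on \<open>D\<close> other than the one at the identity are arbitrary,
  and the augmentation then determines that last one. With \<open>D\<close> the whole group this
  counts \<open>V\<close>; with \<open>D\<close> the set of squares of \<open>G\<close> it counts
  the squares of \<open>V\<close>.\<close>

lemma card_aug_one:
  assumes D: "D \<subseteq> carrier G" "\<one>\<^bsub>G\<^esub> \<in> D"
  shows "card {f \<in> carrier A. (\<forall>x\<in>carrier G - D. f x = \<zero>) \<and> aug f = \<one>} = card (carrier R) ^ (card D - 1)"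
    (is "card ?S = _")
proof -
  let ?D = "D - {\<one>\<^bsub>G\<^esub>}"
  let ?T = "?D \<rightarrow>\<^sub>E carrier R"
  let ?g = "\<lambda>u. \<lambda>x\<in>carrier G. if x = \<one>\<^bsub>G\<^esub> then \<one> \<ominus> (\<Oplus>y\<in>?D. u y) else if x \<in> D then u x else \<zero>"
  have fin: "finite ?D" using D finite_G finite_subset by auto
  have uc: "(\<Oplus>y\<in>?D. u y) \<in> carrier R" if "u \<in> ?T" for u
    using that by (intro finsum_closed) auto
  have gA: "?g u \<in> carrier A" if "u \<in> ?T" for u
    unfolding carrier_A
  proof (rule PiE_I)
    fix x assume "x \<in> carrier G"
    then show "?g u x \<in> carrier R"
      using uc[OF that] PiE_mem[OF that, of x] by (cases "x \<in> ?D") simp_all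
  qed simp
  have aug_split: "aug f = f \<one>\<^bsub>G\<^esub> \<oplus> (\<Oplus>y\<in>?D. f y)"
    if "f \<in> carrier A" "\<forall>x\<in>carrier G - D. f x = \<zero>" for f
  proof -
    have "aug f = (\<Oplus>y\<in>insert \<one>\<^bsub>G\<^esub> ?D. f y)"
      using aug_support[of f D] that D by (simp add: insert_absorb)
    also have "\<dots> = f \<one>\<^bsub>G\<^esub> \<oplus> (\<Oplus>y\<in>?D. f y)"
      using that fin D by (intro add.finprod_insert) auto
    finally show ?thesis .
  qed
  have gsum: "(\<Oplus>y\<in>?D. ?g u y) = (\<Oplus>y\<in>?D. u y)" if "u \<in> ?T" for u
  proof (rule finsum_cong')
    fix y assume "y \<in> ?D"
    then show "?g u y = u y" using D by auto
  qed (use that in auto)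
  have "bij_betw (\<lambda>f. restrict f ?D) ?S ?T"
  proof (rule bij_betw_byWitness[where f' = ?g])
    show "\<forall>f\<in>?S. ?g (restrict f ?D) = f"
    proof
      fix f assume f: "f \<in> ?S"
      have r: "restrict f ?D \<in> ?T" using f D by auto
      have c: "(\<Oplus>y\<in>?D. f y) \<in> carrier R" "f \<one>\<^bsub>G\<^esub> \<in> carrier R" using f D by (auto intro!: finsum_closed)
      have s: "finsum R (restrict f ?D) ?D = finsum R f ?D" using f D by (intro finsum_cong') auto
      have "\<one> = f \<one>\<^bsub>G\<^esub> \<oplus> (\<Oplus>y\<in>?D. f y)" using aug_split[of f] f by auto
      then have fe: "f \<one>\<^bsub>G\<^esub> = \<one> \<ominus> finsum R f ?D" using c by (simp add: minus_eq a_assoc r_neg)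
      show "?g (restrict f ?D) = f"
      proof (rule ext_A[OF gA[OF r]])
        show "f \<in> carrier A" using f by blast
        fix x assume x: "x \<in> carrier G"
        consider "x = \<one>\<^bsub>G\<^esub>" | "x \<in> ?D" | "x \<noteq> \<one>\<^bsub>G\<^esub>" "x \<in> carrier G - D" using x by blast
        then show "?g (restrict f ?D) x = f x"
        proof cases
          case 1
          then show ?thesis using x by (simp add: s fe)
        next
          case 2
          then show ?thesis using x by simp
        next
          case 3
          moreover have "f x = \<zero>" using f 3 by blast
          ultimately show ?thesis using x by simp
        qed
      qed
    qed
    show "\<forall>u\<in>?T. restrict (?g u) ?D = u"
      using D by (auto simp: fun_eq_iff PiE_iff extensional_def)
    show "(\<lambda>f. restrict f ?D) ` ?S \<subseteq> ?T"
    proof (rule image_subsetI)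
      fix f assume "f \<in> ?S"
      then show "restrict f ?D \<in> ?T" using D by auto
    qed
    show "?g ` ?T \<subseteq> ?S"
    proof clarify
      fix u assume u: "u \<in> ?T"
      have "aug (?g u) = ?g u \<one>\<^bsub>G\<^esub> \<oplus> (\<Oplus>y\<in>?D. ?g u y)"
        using D by (intro aug_split gA[OF u]) auto
      also have "(\<Oplus>y\<in>?D. ?g u y) = (\<Oplus>y\<in>?D. u y)" by (rule gsum[OF u])
      also have "?g u \<one>\<^bsub>G\<^esub> \<oplus> (\<Oplus>y\<in>?D. u y) = \<one>"
        using uc[OF u] by (simp add: minus_eq a_assoc l_neg)
      finally have 1: "aug (?g u) = \<one>" .
      show "?g u \<in> carrier A \<and> (\<forall>x\<in>carrier G - D. ?g u x = \<zero>) \<and> aug (?g u) = \<one>"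
      proof (intro conjI ballI gA[OF u] 1)
        fix x assume "x \<in> carrier G - D"
        then show "?g u x = \<zero>" using D by auto
      qed
    qed
  qed
  then have "card ?S = card ?T" by (rule bij_betw_same_card)
  also have "\<dots> = card (carrier R) ^ (card D - 1)"
    using fin D by (simp add: card_PiE card_Diff_singleton)
  finally show ?thesis .
qed

text \<open>The involution sending \<open>x\<close> to \<open>x^-1 y\<close> exchanges the two
  factors in \<open>f(x) f(x^-1 y)\<close>, so moved points cancel in pairs. Its fixed points are
  the solutions of \<open>x^2 = y\<close>.\<close>

lemma square_A:
  assumes two: "\<one> \<oplus> \<one> = \<zero>" and f: "f \<in> carrier A" and y: "y \<in> carrier G"
  shows "(f \<otimes>\<^bsub>A\<^esub> f) y = (\<Oplus>x\<in>{x \<in> carrier G. x \<otimes>\<^bsub>G\<^esub> x = y}. f x \<otimes> f x)"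
proof -
  let ?\<sigma> = "\<lambda>x. inv\<^bsub>G\<^esub> x \<otimes>\<^bsub>G\<^esub> y"
  have two': "a \<oplus> a = \<zero>" if "a \<in> carrier R" for a
    using that two l_distr[of \<one> \<one> a] by simp
  have \<sigma>\<sigma>: "?\<sigma> (?\<sigma> x) = x" if "x \<in> carrier G" for x
    using that y by (simp add: G.inv_mult_group G.m_assoc G.m_comm[of x] inv_mult_cancel)
  have fixed: "?\<sigma> x = x \<longleftrightarrow> x \<otimes>\<^bsub>G\<^esub> x = y" if "x \<in> carrier G" for x
    using that y by (metis G.inv_solve_left)
  have "(f \<otimes>\<^bsub>A\<^esub> f) y = (\<Oplus>x\<in>carrier G. f x \<otimes> f (?\<sigma> x))"
    using f y by (simp add: mult_A)
  also have "\<dots> = (\<Oplus>x\<in>{x \<in> carrier G. ?\<sigma> x = x}. f x \<otimes> f (?\<sigma> x))"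
    using f y \<sigma>\<sigma> by (intro finsum_involution two' finite_G) (auto simp: R.m_comm)
  also have "\<dots> = (\<Oplus>x\<in>{x \<in> carrier G. x \<otimes>\<^bsub>G\<^esub> x = y}. f x \<otimes> f x)"
  proof (rule finsum_cong')
    show "{x \<in> carrier G. ?\<sigma> x = x} = {x \<in> carrier G. x \<otimes>\<^bsub>G\<^esub> x = y}"
      using fixed by blast
    fix x assume "x \<in> {x \<in> carrier G. x \<otimes>\<^bsub>G\<^esub> x = y}"
    then have "?\<sigma> x = x" using fixed by blast
    then show "f x \<otimes> f (?\<sigma> x) = f x \<otimes> f x" by (rule arg_cong)
  qed (use f in auto)
  finally show ?thesis .
qed

text \<open>The square \<open>?h\<close> of \<open>f\<close> is supported on squares of
  \<open>G\<close>, and these have trivial square by the exponent. Squaring again therefore leaves a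
  coefficient only at the identity. It equals the augmentation of the fourth power, which is
  multiplicative.\<close>

lemma fourth_power_A:
  assumes two: "\<one> \<oplus> \<one> = \<zero>" and exp4: "\<And>x. x \<in> carrier G \<Longrightarrow> (x \<otimes>\<^bsub>G\<^esub> x) \<otimes>\<^bsub>G\<^esub> (x \<otimes>\<^bsub>G\<^esub> x) = \<one>\<^bsub>G\<^esub>"
    and f: "f \<in> carrier A"
  shows "(f \<otimes>\<^bsub>A\<^esub> f) \<otimes>\<^bsub>A\<^esub> (f \<otimes>\<^bsub>A\<^esub> f) = single \<one>\<^bsub>G\<^esub> ((aug f \<otimes> aug f) \<otimes> (aug f \<otimes> aug f))"
proof -
  let ?h = "f \<otimes>\<^bsub>A\<^esub> f"
  have h: "?h \<in> carrier A" using f by (simp add: mult_A_closed)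
  have supp: "?h x = \<zero>" if "x \<in> carrier G" "x \<otimes>\<^bsub>G\<^esub> x \<noteq> \<one>\<^bsub>G\<^esub>" for x
  proof -
    have "{z \<in> carrier G. z \<otimes>\<^bsub>G\<^esub> z = x} = {}" using that exp4 by auto
    then show ?thesis by (simp only: square_A[OF two f that(1)] finsum_empty)
  qed
  have zero: "(?h \<otimes>\<^bsub>A\<^esub> ?h) y = \<zero>" if y: "y \<in> carrier G" "y \<noteq> \<one>\<^bsub>G\<^esub>" for y
    unfolding square_A[OF two h y(1)] using supp y by (intro add.finprod_one_eqI) auto
  then have "?h \<otimes>\<^bsub>A\<^esub> ?h = single \<one>\<^bsub>G\<^esub> ((?h \<otimes>\<^bsub>A\<^esub> ?h) \<one>\<^bsub>G\<^esub>)"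
    using h by (intro ext_A) (auto simp: mult_A_closed, auto simp: single_def)
  moreover from this have "aug (?h \<otimes>\<^bsub>A\<^esub> ?h) = (?h \<otimes>\<^bsub>A\<^esub> ?h) \<one>\<^bsub>G\<^esub>"
    using h by (metis G.one_closed aug_single closed_A mult_A_closed)
  ultimately show ?thesis using f h by (simp add: aug_mult)
qed

end

text \<open>Squaring is additive in characteristic 2, so \<open>a^2 = b^2\<close> gives
  \<open>(a + b)^2 = 0\<close>; on a finite set injectivity yields surjectivity.\<close>

lemma (in field) finite_char2_sqrt:
  assumes "finite (carrier R)" "\<one> \<oplus> \<one> = \<zero>"
  shows "inj_on (\<lambda>a. a \<otimes> a) (carrier R)" "(\<lambda>a. a \<otimes> a) ` carrier R = carrier R"
proof -
  show inj: "inj_on (\<lambda>a. a \<otimes> a) (carrier R)"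
  proof (rule inj_onI)
    fix a b assume ab: "a \<in> carrier R" "b \<in> carrier R" "a \<otimes> a = b \<otimes> b"
    have two: "x \<oplus> x = \<zero>" if "x \<in> carrier R" for x
      using that assms(2) l_distr[of \<one> \<one> x] by simp
    have "(a \<oplus> b) \<otimes> (a \<oplus> b) = (a \<otimes> a \<oplus> b \<otimes> b) \<oplus> (a \<otimes> b \<oplus> a \<otimes> b)"
      using ab(1,2) by (simp add: l_distr r_distr m_comm a_ac)
    also have "\<dots> = \<zero>" using ab two by simp
    finally have "a \<oplus> b = \<zero>" using ab integral_iff by simp
    then show "a = b" using ab two[of b] by (metis add.right_cancel)
  qed
  show "(\<lambda>a. a \<otimes> a) ` carrier R = carrier R"
    by (rule endo_inj_surj[OF assms(1) _ inj]) auto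
qed

text \<open>The argument works for every finite abelian group whose exponent divides 4. Only the
  order of \<open>G\<close> and the number of its squares enter the result.\<close>

theorem units_group_algebra_char2:
  assumes F: "field F" "finite (carrier F)" "\<one>\<^bsub>F\<^esub> \<oplus>\<^bsub>F\<^esub> \<one>\<^bsub>F\<^esub> = \<zero>\<^bsub>F\<^esub>" and q: "card (carrier F) = 2 ^ n"
    and G: "comm_group G" "finite (carrier G)" "\<And>x. x \<in> carrier G \<Longrightarrow> (x \<otimes>\<^bsub>G\<^esub> x) \<otimes>\<^bsub>G\<^esub> (x \<otimes>\<^bsub>G\<^esub> x) = \<one>\<^bsub>G\<^esub>"
  defines "D \<equiv> (\<lambda>x. x \<otimes>\<^bsub>G\<^esub> x) ` carrier G"
  defines "m \<equiv> n * (card D - 1)"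
  shows "units_of (group_algebra F G) \<cong> (cyclic_power 4 m \<times>\<times>
    cyclic_power 2 (n * (card (carrier G) - 1) - 2 * m)) \<times>\<times> integer_mod_group (2 ^ n - 1)"
proof -
  interpret F: field F by fact
  interpret G: comm_group G by fact
  interpret finite_group_ring F G by unfold_locales (rule G)
  interpret A: comm_monoid A by (rule comm_monoid_A)
  interpret UA: comm_group "units_of A" by (rule A.units_comm_group)
  have UnitsI: "f \<in> Units A" if f: "f \<in> carrier A" "aug f \<noteq> \<zero>\<^bsub>F\<^esub>" for f
  proof -
    let ?c = "(aug f \<otimes>\<^bsub>F\<^esub> aug f) \<otimes>\<^bsub>F\<^esub> (aug f \<otimes>\<^bsub>F\<^esub> aug f)"
    have c: "?c \<in> Units F" using f by (simp add: F.field_Units F.integral_iff)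
    let ?d = "single \<one>\<^bsub>G\<^esub> (inv\<^bsub>F\<^esub> ?c)"
    \<comment> \<open>The inverse is \<open>f^3\<close> divided by the fourth power of the
      augmentation, since \<open>f^4\<close> is that scalar.\<close>
    let ?k = "f \<otimes>\<^bsub>A\<^esub> ((f \<otimes>\<^bsub>A\<^esub> f) \<otimes>\<^bsub>A\<^esub> ?d)"
    have d: "?d \<in> carrier A" using c by simp
    have "f \<otimes>\<^bsub>A\<^esub> ?k = ((f \<otimes>\<^bsub>A\<^esub> f) \<otimes>\<^bsub>A\<^esub> (f \<otimes>\<^bsub>A\<^esub> f)) \<otimes>\<^bsub>A\<^esub> ?d"
      using f d by (simp add: A.m_assoc)
    also have "\<dots> = \<one>\<^bsub>A\<^esub>"
      by (simp only: fourth_power_A[OF F(3) G(3) f(1)] one_A F.Units_r_inv[OF c]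
        single_mult_single[OF F.Units_closed[OF c] F.Units_inv_closed[OF c]])
    finally show ?thesis using f d A.m_comm[of f ?k] by (auto simp: Units_def intro!: bexI[of _ ?k])
  qed
  have aug_Units: "aug f \<in> Units F" if f: "f \<in> Units A" for f
  proof -
    have "aug f \<otimes>\<^bsub>F\<^esub> aug (inv\<^bsub>A\<^esub> f) = \<one>\<^bsub>F\<^esub>"
      using f by (simp add: aug_mult[symmetric] aug_one A.Units_closed)
    then show ?thesis using f by (auto simp: F.field_Units A.Units_closed)
  qed
  have hom_aug: "aug \<in> hom (units_of A) (units_of F)"
    by (rule homI) (auto simp: units_of_carrier units_of_mult aug_Units aug_mult A.Units_closed)
  \<comment> \<open>The scalars are a section of the augmentation, which splits off the units of
    \<open>F\<close>.\<close>
  have "single \<one>\<^bsub>G\<^esub> \<in> hom (units_of F) (units_of A)"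
    by (rule homI)
      (auto simp: units_of_carrier units_of_mult single_mult_single F.field_Units aug_single intro!: UnitsI)
  then have split: "units_of A \<cong> (units_of A)\<lparr>carrier := kernel (units_of A) (units_of F) aug\<rparr> \<times>\<times> units_of F"
    by (intro UA.split_epi_iso F.units_group hom_aug)
      (auto simp: units_of_carrier aug_single)
  let ?V = "(units_of A)\<lparr>carrier := kernel (units_of A) (units_of F) aug\<rparr>"
  have V: "carrier ?V = {f \<in> carrier A. aug f = \<one>\<^bsub>F\<^esub>}"
    using UnitsI by (auto simp: kernel_def units_of_carrier units_of_one A.Units_closed)
  interpret UF: group "units_of F" by (rule F.units_group)
  interpret aug: group_hom "units_of A" "units_of F" aug
    by unfold_locales (rule hom_aug)
  interpret V: comm_group ?V
  proof (rule group.group_comm_groupI)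
    show "group ?V" by (rule UA.subgroup_imp_group[OF aug.subgroup_kernel])
  qed (auto simp: kernel_def intro: UA.m_comm)
  have V2: "f [^]\<^bsub>?V\<^esub> (2::nat) = f \<otimes>\<^bsub>A\<^esub> f" if "f \<in> carrier ?V" for f
  proof -
    have "f [^]\<^bsub>?V\<^esub> (2::nat) = f \<otimes>\<^bsub>?V\<^esub> f"
      by (simp only: numeral_2_eq_2 V.nat_pow_Suc V.nat_pow_0 V.l_one[OF that])
    then show ?thesis by (simp add: units_of_mult)
  qed
  have fin: "finite (carrier ?V)"
  proof -
    have "finite (carrier A)" by (simp add: carrier_A F(2) G(2) finite_PiE)
    then show ?thesis by (rule finite_subset[rotated]) (auto simp: V)
  qed
  have V4: "f [^]\<^bsub>?V\<^esub> (4::nat) = \<one>\<^bsub>?V\<^esub>" if f: "f \<in> carrier ?V" for f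
  proof -
    have "f [^]\<^bsub>?V\<^esub> (4::nat) = (f [^]\<^bsub>?V\<^esub> (2::nat)) [^]\<^bsub>?V\<^esub> (2::nat)"
      using V.nat_pow_pow[OF f, of 2 2] by simp
    also have "\<dots> = (f \<otimes>\<^bsub>A\<^esub> f) \<otimes>\<^bsub>A\<^esub> (f \<otimes>\<^bsub>A\<^esub> f)"
      using V2[OF f] V2[of "f [^]\<^bsub>?V\<^esub> (2::nat)"] V.nat_pow_closed[OF f, of 2] by simp
    also have "\<dots> = \<one>\<^bsub>A\<^esub>"
      using f fourth_power_A[OF F(3) G(3), of f] by (simp add: V one_A)
    finally show ?thesis by (simp add: units_of_one)
  qed
  have D: "D \<subseteq> carrier G" "\<one>\<^bsub>G\<^esub> \<in> D"
    by (auto simp: D_def intro!: image_eqI[of _ _ "\<one>\<^bsub>G\<^esub>"])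
  have "order ?V = card (carrier F) ^ (card (carrier G) - 1)"
    using card_aug_one[of "carrier G"] by (simp add: order_def V)
  then have oV: "order ?V = 2 ^ (n * (card (carrier G) - 1))" by (simp add: q power_mult)
  have sqS: "(\<lambda>f. f [^]\<^bsub>?V\<^esub> (2::nat)) ` carrier ?V
      = {f \<in> carrier A. (\<forall>x\<in>carrier G - D. f x = \<zero>\<^bsub>F\<^esub>) \<and> aug f = \<one>\<^bsub>F\<^esub>}" (is "?sq = ?S")
  proof
    show "?sq \<subseteq> ?S"
    proof
      fix h assume "h \<in> ?sq"
      then obtain f where f: "f \<in> carrier ?V" "h = f \<otimes>\<^bsub>A\<^esub> f" using V2 by auto
      then have f': "f \<in> carrier A" "aug f = \<one>\<^bsub>F\<^esub>" by (auto simp: V)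
      have "h x = \<zero>\<^bsub>F\<^esub>" if x: "x \<in> carrier G - D" for x
      proof -
        have "{z \<in> carrier G. z \<otimes>\<^bsub>G\<^esub> z = x} = {}" using x by (auto simp: D_def)
        then show ?thesis
          by (simp only: f(2) square_A[OF F(3) f'(1) DiffD1[OF x]] F.finsum_empty)
      qed
      then show "h \<in> ?S" using f f' by (simp add: mult_A_closed aug_mult)
    qed
    show "?S \<subseteq> ?sq"
    proof
      fix h assume h: "h \<in> ?S"
      then have hA: "h \<in> carrier A" and h0: "\<And>x. x \<in> carrier G \<Longrightarrow> x \<notin> D \<Longrightarrow> h x = \<zero>\<^bsub>F\<^esub>"
        and h1: "aug h = \<one>\<^bsub>F\<^esub>" by auto
      define r where "r y = (SOME x. x \<in> carrier G \<and> x \<otimes>\<^bsub>G\<^esub> x = y)" for y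
      have r: "r y \<in> carrier G" "r y \<otimes>\<^bsub>G\<^esub> r y = y" if "y \<in> D" for y
      proof -
        have "\<exists>x. x \<in> carrier G \<and> x \<otimes>\<^bsub>G\<^esub> x = y" using that by (auto simp: D_def)
        from someI_ex[OF this] show "r y \<in> carrier G" "r y \<otimes>\<^bsub>G\<^esub> r y = y" by (auto simp: r_def)
      qed
      define s where "s a = (SOME b. b \<in> carrier F \<and> b \<otimes>\<^bsub>F\<^esub> b = a)" for a
      have s: "s a \<in> carrier F" "s a \<otimes>\<^bsub>F\<^esub> s a = a" if "a \<in> carrier F" for a
      proof -
        have "\<exists>b. b \<in> carrier F \<and> b \<otimes>\<^bsub>F\<^esub> b = a"
          using that F.finite_char2_sqrt(2)[OF F(2,3)] by (metis (no_types, lifting) imageE)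
        from someI_ex[OF this] show "s a \<in> carrier F" "s a \<otimes>\<^bsub>F\<^esub> s a = a" by (auto simp: s_def)
      qed
      \<comment> \<open>For each square \<open>y\<close>, a square root of \<open>h y\<close> is
        placed at the single chosen root \<open>r y\<close> of \<open>y\<close>, so the sum over all
        roots of \<open>y\<close> in the square of \<open>f\<close> has just one nonzero candidate
        term.\<close>
      define f where "f = (\<lambda>x\<in>carrier G. if x \<in> r ` D then s (h (x \<otimes>\<^bsub>G\<^esub> x)) else \<zero>\<^bsub>F\<^esub>)"
      have fA: "f \<in> carrier A"
        using s hA by (auto simp: f_def carrier_A)
      have ff: "f \<otimes>\<^bsub>A\<^esub> f = h"
      proof (rule ext_A[OF _ hA])
        show "f \<otimes>\<^bsub>A\<^esub> f \<in> carrier A" using fA by (simp add: mult_A_closed)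
        fix y assume y: "y \<in> carrier G"
        let ?X = "{x \<in> carrier G. x \<otimes>\<^bsub>G\<^esub> x = y}"
        show "(f \<otimes>\<^bsub>A\<^esub> f) y = h y"
        proof (cases "y \<in> D")
          case False
          then have "?X = {}" by (auto simp: D_def)
          then show ?thesis by (simp only: square_A[OF F(3) fA y] h0[OF y False] F.finsum_empty)
        next
          case True
          have "(\<Oplus>\<^bsub>F\<^esub>x\<in>?X. f x \<otimes>\<^bsub>F\<^esub> f x) = (\<Oplus>\<^bsub>F\<^esub>x\<in>{r y}. f x \<otimes>\<^bsub>F\<^esub> f x)"
          proof (rule F.add.finprod_mono_neutral_cong_right)
            show "finite ?X" using G(2) by simp
            show "{r y} \<subseteq> ?X" using r[OF True] by simp
            show "f x \<otimes>\<^bsub>F\<^esub> f x = \<zero>\<^bsub>F\<^esub>" if x: "x \<in> ?X - {r y}" for x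
            proof -
              have "x \<notin> r ` D" using x r(2) by auto
              then show ?thesis using x by (simp add: f_def)
            qed
          qed (use fA in auto)
          also have "\<dots> = f (r y) \<otimes>\<^bsub>F\<^esub> f (r y)" using fA r[OF True] by simp
          also have "f (r y) = s (h y)" using r[OF True] True by (simp add: f_def)
          also have "s (h y) \<otimes>\<^bsub>F\<^esub> s (h y) = h y" using s hA y by auto
          finally show ?thesis using square_A[OF F(3) fA y] by simp
        qed
      qed
      \<comment> \<open>The augmentation of \<open>f\<close> squares to 1, and it is 1 itself
        because squaring is injective on \<open>F\<close>.\<close>
      have "aug f \<otimes>\<^bsub>F\<^esub> aug f = \<one>\<^bsub>F\<^esub> \<otimes>\<^bsub>F\<^esub> \<one>\<^bsub>F\<^esub>"
        by (simp add: aug_mult[OF fA fA, symmetric] ff h1)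
      then have "aug f = \<one>\<^bsub>F\<^esub>"
        using inj_onD[OF F.finite_char2_sqrt(1)[OF F(2,3)], of "aug f" "\<one>\<^bsub>F\<^esub>"] fA by simp
      then have f: "f \<in> carrier ?V" using fA by (simp add: V)
      have "h = f [^]\<^bsub>?V\<^esub> (2::nat)" unfolding V2[OF f] by (rule ff[symmetric])
      then show "h \<in> ?sq" using f by (rule image_eqI)
    qed
  qed
  have sq: "card ?sq = 2 ^ m"
    unfolding sqS card_aug_one[OF D] q m_def by (simp only: power_mult)
  have V_iso: "?V \<cong> cyclic_power 4 m \<times>\<times> cyclic_power 2 (n * (card (carrier G) - 1) - 2 * m)"
  proof (rule V.exponent4_structure)
    show "finite (carrier ?V)" by (rule fin)
    show "f [^]\<^bsub>?V\<^esub> (4::nat) = \<one>\<^bsub>?V\<^esub>" if "f \<in> carrier ?V" for f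
      by (rule V4[OF that])
    show "order ?V = 2 ^ (n * (card (carrier G) - 1))" by (rule oV)
    show "card ?sq = 2 ^ m" by (rule sq)
  qed
  have F_iso: "units_of F \<cong> integer_mod_group (2 ^ n - 1)"
    using units_of_finite_field[OF F(1,2)] by (simp add: q)
  show ?thesis by (rule iso_trans[OF split DirProd_cong[OF V_iso F_iso]])
qed

section \<open>The unit group\<close>

lemma C4C4C2_exponent_4:
  assumes "g \<in> carrier C4C4C2"
  shows "(g \<otimes>\<^bsub>C4C4C2\<^esub> g) \<otimes>\<^bsub>C4C4C2\<^esub> (g \<otimes>\<^bsub>C4C4C2\<^esub> g) = \<one>\<^bsub>C4C4C2\<^esub>"
proof -
  have two: "x + x = 2 * x" for x :: int by simp
  obtain a b c where g: "g = tup a b c" using assms by (rule tup_cases)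
  have "(2 * (2 * x mod 4)) mod 4 = 0" for x :: int by presburger
  moreover have "(2 * (2 * x mod 2)) mod 2 = 0" for x :: int by simp
  ultimately show ?thesis unfolding g tup_mult tup_one two by simp
qed

lemma C4C4C2_squares:
  "(\<lambda>g. g \<otimes>\<^bsub>C4C4C2\<^esub> g) ` carrier C4C4C2 = (\<lambda>(a, b). tup a b 0) ` ({0, 2} \<times> {0, 2})"
proof
  show "(\<lambda>g. g \<otimes>\<^bsub>C4C4C2\<^esub> g) ` carrier C4C4C2 \<subseteq> (\<lambda>(a, b). tup a b 0) ` ({0, 2} \<times> {0, 2})"
  proof (rule image_subsetI)
    fix g assume "g \<in> carrier C4C4C2"
    then obtain a b c where g: "g = tup a b c" by (rule tup_cases)
    have "(x + x) mod 4 \<in> {0, 2}" for x :: int by (simp, presburger)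
    moreover have "(x + x) mod 2 = 0" for x :: int by presburger
    ultimately show "g \<otimes>\<^bsub>C4C4C2\<^esub> g \<in> (\<lambda>(a, b). tup a b 0) ` ({0, 2} \<times> {0, 2})"
      unfolding g tup_mult by (intro image_eqI[of _ _ "((a + a) mod 4, (b + b) mod 4)"] SigmaI) simp_all
  qed
  show "(\<lambda>(a, b). tup a b 0) ` ({0, 2} \<times> {0, 2}) \<subseteq> (\<lambda>g. g \<otimes>\<^bsub>C4C4C2\<^esub> g) ` carrier C4C4C2"
  proof (rule image_subsetI)
    fix x :: "int \<times> int" assume "x \<in> {0, 2} \<times> {0, 2}"
    then obtain a b where x: "x = (a, b)" and ab: "a \<in> {0, 2}" "b \<in> {0, 2}" by blast
    have "tup a b 0 = tup (a div 2) (b div 2) 0 \<otimes>\<^bsub>C4C4C2\<^esub> tup (a div 2) (b div 2) 0"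
      using ab by (auto simp: tup_mult)
    moreover have "tup (a div 2) (b div 2) 0 \<in> carrier C4C4C2" using ab by auto
    ultimately show "(case x of (a, b) \<Rightarrow> tup a b 0) \<in> (\<lambda>g. g \<otimes>\<^bsub>C4C4C2\<^esub> g) ` carrier C4C4C2"
      unfolding x prod.case by (rule image_eqI)
  qed
qed

lemma card_C4C4C2_squares: "card ((\<lambda>g. g \<otimes>\<^bsub>C4C4C2\<^esub> g) ` carrier C4C4C2) = 4"
proof -
  have "inj_on (\<lambda>(a, b). tup a b 0) ({0, 2} \<times> {0, 2})" by (auto simp: inj_on_def)
  then show ?thesis unfolding C4C4C2_squares by (simp add: card_image card_cartesian_product)
qed

text \<open>The characteristic is the additive order of 1, so this is the divisibility criterion for
  an order. It decides whether 2 and 32 vanish in the field.\<close>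

lemma (in ring) add_pow_one_eq_zero_iff:
  fixes k :: nat
  shows "[k] \<cdot> \<one> = \<zero> \<longleftrightarrow> characteristic R dvd k"
  using add.pow_eq_id[of \<one> k] by (simp add: characteristic_def add_pow_def)

theorem theorem3p5:
  fixes F :: "('a, 'b) ring_scheme" and p n q :: nat
  assumes "Factorial_Ring.prime p" and "n \<ge> 1" and "q = p ^ n"
    and "field F" and "finite (carrier F)" and "characteristic F = p" and "order F = q"
  defines "U \<equiv> units_of (group_algebra F (cyclic_power 4 2 \<times>\<times> integer_mod_group 2))"
  shows
    "(p = 2 \<longrightarrow>
        U \<cong> cyclic_power 4 (3 * n) \<times>\<times> cyclic_power 2 (25 * n) \<times>\<times> integer_mod_group (2 ^ n - 1)) \<and>
     (p \<noteq> 2 \<longrightarrow>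
        ([int q = 1] (mod 4) \<longrightarrow>
          U \<cong> cyclic_power (p ^ n - 1) 32) \<and>
        ([int q = - 1] (mod 4) \<longrightarrow>
          U \<cong> cyclic_power (p ^ n - 1) 8 \<times>\<times> cyclic_power (p ^ (2 * n) - 1) 12))"
proof -
  interpret F: field F by fact
  have q: "card (carrier F) = p ^ n" using assms(3,7) by (simp add: order_def)
  have U: "U = units_of (group_algebra F C4C4C2)" by (simp add: U_def C4C4C2_def)
  have two: "[(2::nat)] \<cdot>\<^bsub>F\<^esub> \<one>\<^bsub>F\<^esub> = \<one>\<^bsub>F\<^esub> \<oplus>\<^bsub>F\<^esub> \<one>\<^bsub>F\<^esub>"
    by (simp add: numeral_2_eq_2 F.add.nat_pow_Suc)
  show ?thesis
  proof (intro conjI impI)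
    assume p: "p = 2"
    have "\<one>\<^bsub>F\<^esub> \<oplus>\<^bsub>F\<^esub> \<one>\<^bsub>F\<^esub> = \<zero>\<^bsub>F\<^esub>"
      using F.add_pow_one_eq_zero_iff[of 2] assms(6) p two by simp
    then have "U \<cong> (cyclic_power 4 (n * (4 - 1)) \<times>\<times> cyclic_power 2 (n * (32 - 1) - 2 * (n * (4 - 1))))
        \<times>\<times> integer_mod_group (2 ^ n - 1)"
      using units_group_algebra_char2[OF assms(4,5) _ q[unfolded p] comm_group_C4C4C2
          finite_C4C4C2 C4C4C2_exponent_4]
      unfolding U card_C4C4C2 card_C4C4C2_squares by blast
    \<comment> \<open>From 31n the two exponents contributed by each of the 3n factors of order 4
      are removed: 31n - 6n = 25n.\<close>
    also have "n * (32 - 1) - 2 * (n * (4 - 1)) = 25 * n" by simp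
    also have "n * (4 - 1) = 3 * n" by simp
    also note DirProd_assoc_iso
    finally show "U \<cong> cyclic_power 4 (3 * n) \<times>\<times> cyclic_power 2 (25 * n) \<times>\<times> integer_mod_group (2 ^ n - 1)" .
  next
    assume p: "p \<noteq> 2"
    \<comment> \<open>Used for \<open>k = 5\<close>, the group order 32, which makes Fourier
      inversion possible, and for \<open>k = 1\<close>, which separates 1 from -1.\<close>
    have "\<not> p dvd 2 ^ k" for k
      using p assms(1) by (metis prime_dvd_power primes_dvd_imp_eq two_is_prime_nat)
    from this[of 5] this[of 1] have "\<not> p dvd 32" "\<not> p dvd 2" by simp_all
    then have 32: "[(32::nat)] \<cdot>\<^bsub>F\<^esub> \<one>\<^bsub>F\<^esub> \<noteq> \<zero>\<^bsub>F\<^esub>" and 2: "\<one>\<^bsub>F\<^esub> \<oplus>\<^bsub>F\<^esub> \<one>\<^bsub>F\<^esub> \<noteq> \<zero>\<^bsub>F\<^esub>"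
      using F.add_pow_one_eq_zero_iff[of 32] F.add_pow_one_eq_zero_iff[of 2] assms(6) two by simp_all
    {
      assume "[int q = 1] (mod 4)"
      then have "[q = 1] (mod 4)" using cong_int_iff[of q 1 4] by simp
      \<comment> \<open>Subtraction of naturals truncates, so \<open>q \<ge> 1\<close> is required
        to read the congruence as divisibility of \<open>q - 1\<close>.\<close>
      moreover have "q \<ge> 1" using prime_gt_0_nat[OF assms(1)] assms(3) by (simp add: Suc_le_eq)
      ultimately have "4 dvd card (carrier F) - 1"
        using cong_altdef_nat[of 1 q 4] assms(3) q by simp
      then show "U \<cong> cyclic_power (p ^ n - 1) 32"
        using finite_field_primitive_fourth_root[OF assms(4,5)] units_group_algebra_split[OF assms(4,5) 32]
        unfolding U q by blast
    }
    {
      assume "[int q = - 1] (mod 4)"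
      then have "[int q = int 3] (mod int 4)" by (simp add: cong_def)
      then have "[card (carrier F) = 3] (mod 4)" using assms(3) q by (simp only: cong_int_iff)
      from units_group_algebra_nonsplit[OF assms(4,5) 32 2 finite_field_no_sqrt_minus_one[OF assms(4,5) this 2]]
      show "U \<cong> cyclic_power (p ^ n - 1) 8 \<times>\<times> cyclic_power (p ^ (2 * n) - 1) 12"
        unfolding U q by (simp add: power_mult[symmetric] mult.commute)
    }
  qed
qed

end
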